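(* For $\theta>0$ let $\Xi_\theta$ be the law of $\mathbf{P}(\theta)=(P_1(\theta),P_2(\theta),\ldots)$ (the Poisson–Dirichlet distribution with parameter $\theta$), regarded as a probability measure on $\bar{\nabla}$. Then the family $\{\Xi_\theta:\theta>0\}$ satisfies a large deviation principle on $\bar\nabla$ (as $\theta\to\infty$) with speed $\theta$ and rate function $$S(\mathbf{p})=\begin{cases}\log\dfrac{1}{1-\sum_{k=1}^\infty p_k}, & \mathbf{p}=(p_1,p_2,\ldots)\in\bar\nabla,\ \sum_{k=1}^\infty p_k<1,\\ \infty, & \text{else.}\end{cases}$$
   Context: **Large deviation principle (LDP).** Let $E$ be a complete separable metric space. A family $\{Q_\theta:\theta>0\}$ of probability measures on $E$ satisfies an LDP (as $\theta\to\infty$) with speed $\theta$ and rate function $I:E\to[0,\infty]$ if for every closed $F\subset E$ and every open $G\subset E$, $\limsup_{\theta\to\infty}\frac1\theta\log Q_\theta\{F\}\le-\inf_{x\in F}I(x)$ and $\liminf_{\theta\to\infty}\frac1\theta\log Q_\theta\{G\}\ge-\inf_{x\in G}I(x)$, and for every $c>0$ the set $\{x:I(x)\le c\}$ is compact. (Conventions: $\log 0=-\infty$, $\inf\emptyset=\infty$.) **The Poisson–Dirichlet distribution.** For $\theta>0$, let $U_1,U_2,\ldots$ be i.i.d. with $Beta(1,\theta)$ distribution (density $\theta(1-x)^{\theta-1}$ on $(0,1)$). Put $X_1=U_1$ and $X_k=(1-U_1)\cdots(1-U_{k-1})U_k$ for $k\ge2$. Let $P_k(\theta)$ be the $k$th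 largest among $X_1,X_2,\ldots$, i.e. $\mathbf{P}(\theta)=(P_1(\theta),P_2(\theta),\ldots)$ is the sequence $(X_k)$ rearranged in descending order. The law of $\mathbf{P}(\theta)$ is the Poisson–Dirichlet distribution $PD(\theta)$. **State space.** $\bar\nabla=\{(p_1,p_2,\ldots):p_1\ge p_2\ge\cdots\ge0,\ \sum_{k=1}^\infty p_k\le1\}$, with the subspace topology inherited from the product topology of $\mathbb{R}^\infty$; it is metrized by $d(\mathbf{p},\mathbf{q})=\sum_{k=1}^\infty|p_k-q_k|/2^k$ and is compact. *)

theory Defs
  imports "HOL-Probability.Probability"
begin

section \<open>Large deviation principles\<close>

definition log_ext :: "real \<Rightarrow> ereal" where
  "log_ext x = (if x = 0 then -\<infinity> else ereal (ln x))"

text \<open>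
  The space \<open>E\<close> is a complete subset of a second countable metric type, hence a complete
  separable metric space; open and closed subsets of \<open>E\<close>, and its Borel sets, are those of the
  subspace topology. The speed is \<open>\<theta>\<close>. The infimum of the empty set in \<open>ereal\<close> is \<open>\<infinity>\<close>.
\<close>

definition satisfies_LDP ::
  "'a::{metric_space, second_countable_topology} set \<Rightarrow> (real \<Rightarrow> 'a measure) \<Rightarrow> ('a \<Rightarrow> ereal) \<Rightarrow> bool"
where
  "satisfies_LDP E Q I \<longleftrightarrow>
     Topological_Spaces.complete E \<and>
     (\<forall>\<theta>>0. prob_space (Q \<theta>) \<and> space (Q \<theta>) = E \<and> sets (Q \<theta>) = sets (restrict_space borel E)) \<and>
     (\<forall>x\<in>E. 0 \<le> I x) \<and>
     (\<forall>F. closedin (top_of_set E) F \<longrightarrow>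
        Limsup at_top (\<lambda>\<theta>. ereal (1 / \<theta>) * log_ext (measure (Q \<theta>) F)) \<le> - (INF x\<in>F. I x)) \<and>
     (\<forall>G. openin (top_of_set E) G \<longrightarrow>
        Liminf at_top (\<lambda>\<theta>. ereal (1 / \<theta>) * log_ext (measure (Q \<theta>) G)) \<ge> - (INF x\<in>G. I x)) \<and>
     (\<forall>c::real. c > 0 \<longrightarrow> compact {x \<in> E. I x \<le> ereal c})"

section \<open>The Poisson--Dirichlet distribution\<close>

text \<open>
  Sequences are functions on \<open>nat\<close>, so all indices are shifted down by one. The type
  \<open>nat \<Rightarrow> real\<close> carries the product topology.
\<close>

definition nabla_bar :: "(nat \<Rightarrow> real) set" where
  "nabla_bar = {p. decseq p \<and> (\<forall>k. 0 \<le> p k) \<and> summable p \<and> (\<Sum>k. p k) \<le> 1}"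

definition beta1 :: "real \<Rightarrow> real measure" where
  "beta1 \<theta> = density (restrict_space lborel {0<..<1}) (\<lambda>x. ennreal (\<theta> * (1 - x) powr (\<theta> - 1)))"

definition stick_breaking :: "(nat \<Rightarrow> real) \<Rightarrow> nat \<Rightarrow> real" where
  "stick_breaking u k = (\<Prod>i<k. 1 - u i) * u k"

text \<open>
  The rearrangement is unique if it exists. It exists for every strictly positive sequence
  tending to \<open>0\<close>, in particular for \<open>stick_breaking u\<close> whenever all \<open>u i\<close> lie in \<open>(0,1)\<close>,
  i.e. everywhere on the space underlying \<open>poisson_dirichlet \<theta>\<close> below.
\<close>

definition descending_rearrangement :: "(nat \<Rightarrow> real) \<Rightarrow> nat \<Rightarrow> real" where
  "descending_rearrangement x = (THE p. decseq p \<and> (\<exists>\<sigma>. bij \<sigma> \<and> p = x \<circ> \<sigma>))"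

definition poisson_dirichlet :: "real \<Rightarrow> (nat \<Rightarrow> real) measure" where
  "poisson_dirichlet \<theta> =
     distr (Pi\<^sub>M UNIV (\<lambda>_. beta1 \<theta>)) (restrict_space borel nabla_bar)
       (\<lambda>u. descending_rearrangement (stick_breaking u))"

definition rate_S :: "(nat \<Rightarrow> real) \<Rightarrow> ereal" where
  "rate_S p =
     (if p \<in> nabla_bar \<and> (\<Sum>k. p k) < 1 then ereal (ln (1 / (1 - (\<Sum>k. p k)))) else \<infinity>)"

end

theory Submission
  imports Defs
begin

text \<open>
  Under the Beta law a break leaves at most the fraction \<open>v\<close> of the stick with probability
  \<open>v powr \<theta>\<close>. Breaking off pieces of sizes close to \<open>p 0, ..., p (n - 1)\<close> one after the other
  therefore has probability close to \<open>(1 - (p 0 + ... + p (n - 1))) powr \<theta>\<close>, up to factors that do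
  not matter at exponential scale: the fractions left over telescope, and the individual sizes drop out.
  All other sticks are small at no cost. This explains the rate \<open>- ln (1 - (\<Sum>k. p k))\<close>, and it
  is turned into the lower bound in \<open>eventually_sticks_close\<close>. No sorting is involved there: the
  descending rearrangement does not increase the distance in the supremum norm
  (\<open>descending_rearrangement_nonexpansive\<close>), so it suffices that the unsorted sticks are close to \<open>p\<close>.

  For the upper bound, closed subsets of the state space are compact, and compactness reduces the claim
  to one family of events: the \<open>n\<close> largest sticks have total length at least \<open>a\<close>, for fixed \<open>n\<close>. The
  difficulty is that these sticks may occur anywhere in the sequence, so that infinitely many choices of
  indices compete. Instead of the joint density of the sorted sticks, the proof uses the self-similarity
  of stick breaking. Let \<open>M\<close> be the largest sum of at most \<open>n\<close> sticks. Either the first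
  stick contributes to \<open>M\<close>, and the problem reduces to \<open>n - 1\<close> sticks of the remaining
  copy, or it does not, and the copy has merely been shortened. The moment of order \<open>\<rho> * \<theta>\<close> of
  \<open>1 / (1 - M)\<close> is contracted by such a shortening (\<open>nn_integral_beta1_contract\<close>), up to
  an additive term, at a rate independent of \<open>\<theta>\<close>. Hence this moment is bounded by a constant times
  \<open>(1 / (1 - d)) powr (\<rho> * \<theta>)\<close>, for any \<open>\<rho> < 1\<close> and \<open>d > 0\<close>
  (\<open>top_sum_moment\<close>), and Markov's inequality gives the rate \<open>ln (1 / (1 - a))\<close> in the limit
  \<open>\<rho> \<rightarrow> 1\<close>, \<open>d \<rightarrow> 0\<close>.
\<close>

section \<open>Descending rearrangements\<close>

text \<open>
  The right-hand side does not mention the rearrangement: the \<open>k\<close>-th entry is determined by counting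
  how many entries of \<open>x\<close> reach a given level. Uniqueness, measurability and stability of the
  descending rearrangement are all read off from this equivalence.
\<close>
lemma rearrangement_ge_iff:
  fixes p x :: "nat \<Rightarrow> real"
  assumes "decseq p" "bij \<sigma>" "p = x \<circ> \<sigma>"
  shows "t \<le> p k \<longleftrightarrow> (\<exists>J. finite J \<and> card J = Suc k \<and> (\<forall>j\<in>J. t \<le> x j))"
proof
  assume t: "t \<le> p k"
  have "inj_on \<sigma> {..k}" using assms(2) by (auto simp: bij_def inj_on_def)
  then have "card (\<sigma> ` {..k}) = Suc k" by (simp add: card_image)
  moreover have "t \<le> x j" if "j \<in> \<sigma> ` {..k}" for j
  proof -
    from that obtain i where "i \<le> k" "j = \<sigma> i" by auto
    then show ?thesis using t decseqD[OF assms(1), of i k] assms(3) by simp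
  qed
  ultimately show "\<exists>J. finite J \<and> card J = Suc k \<and> (\<forall>j\<in>J. t \<le> x j)"
    by (intro exI[of _ "\<sigma> ` {..k}"]) auto
next
  assume "\<exists>J. finite J \<and> card J = Suc k \<and> (\<forall>j\<in>J. t \<le> x j)"
  then obtain J where J: "finite J" "card J = Suc k" "\<forall>j\<in>J. t \<le> x j" by auto
  have "\<not> J \<subseteq> \<sigma> ` {..<k}"
  proof
    assume "J \<subseteq> \<sigma> ` {..<k}"
    then have "card J \<le> card (\<sigma> ` {..<k})" by (intro card_mono) auto
    also have "\<dots> \<le> k" using card_image_le[of "{..<k}" \<sigma>] by simp
    finally show False using J by simp
  qed
  then obtain j where j: "j \<in> J" "j \<notin> \<sigma> ` {..<k}" by auto
  obtain i where i: "j = \<sigma> i" using assms(2) by (metis bij_pointE)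
  with j have "k \<le> i" by (metis image_eqI lessThan_iff not_le)
  then have "p i \<le> p k" by (rule decseqD[OF assms(1)])
  then show "t \<le> p k" using J j i assms(3) by fastforce
qed

text \<open>
  Order the indices by decreasing value, ties broken by the index. Since \<open>x\<close> is positive and tends to
  \<open>0\<close>, every index has finitely many predecessors, and their number is a bijective rank function.
\<close>
lemma decseq_rearrangement_exists:
  fixes x :: "nat \<Rightarrow> real"
  assumes pos: "\<And>i. 0 < x i" and lim: "x \<longlonglongrightarrow> 0"
  obtains \<sigma> where "bij \<sigma>" "decseq (x \<circ> \<sigma>)"
proof -
  define before where "before = (\<lambda>i j. x j < x i \<or> x i = x j \<and> i < j)"
  define rank where "rank = (\<lambda>j. card {i. before i j})"
  have fin: "finite {i. before i j}" for j
  proof -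
    have "\<forall>\<^sub>F i in sequentially. x i < x j" using lim pos[of j] by (rule order_tendstoD)
    then obtain N where "\<And>i. i \<ge> N \<Longrightarrow> x i < x j" by (auto simp: eventually_sequentially)
    then have "{i. before i j} \<subseteq> {..<N}"
      unfolding before_def by (smt (verit) lessThan_iff mem_Collect_eq not_le subsetI)
    then show ?thesis by (rule finite_subset) simp
  qed
  have trans: "before i l" if "before i j" "before j l" for i j l
    using that unfolding before_def by auto
  have total: "before i j \<or> before j i" if "i \<noteq> j" for i j
    using that unfolding before_def by auto
  have irrefl: "\<not> before i i" for i unfolding before_def by auto
  have mono: "rank i < rank j" if "before i j" for i j
    unfolding rank_def using that trans irrefl by (intro psubset_card_mono fin) blast
  have inj: "inj rank" by (rule injI) (metis mono total less_irrefl)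
  \<comment> \<open>The range of \<open>rank\<close> is downward closed; being infinite, it is everything.\<close>
  have down: "rank ` {i. before i j} = {..<rank j}" for j
  proof (rule card_subset_eq)
    show "rank ` {i. before i j} \<subseteq> {..<rank j}" using mono by auto
    show "card (rank ` {i. before i j}) = card {..<rank j}"
      using card_image[OF inj_on_subset[OF inj subset_UNIV]] by (simp add: rank_def)
  qed simp
  have "m \<in> range rank" for m
  proof -
    have "infinite (range rank)" using inj by (simp add: finite_image_iff)
    then obtain j where "m < rank j" by (metis infinite_nat_iff_unbounded imageE)
    then show ?thesis using down[of j] by blast
  qed
  then have bij: "bij rank" using inj by (auto simp: bij_def)
  have "decseq (x \<circ> inv rank)"
  proof (rule decseq_SucI, rule ccontr)
    fix n assume "\<not> (x \<circ> inv rank) (Suc n) \<le> (x \<circ> inv rank) n"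
    then have "before (inv rank (Suc n)) (inv rank n)" by (simp add: before_def)
    from mono[OF this] show False using bij by (simp add: bij_is_surj surj_f_inv_f)
  qed
  with bij show ?thesis by (intro that[of "inv rank"]) (auto simp: bij_imp_bij_inv)
qed

lemma descending_rearrangement_ex:
  fixes x :: "nat \<Rightarrow> real"
  assumes "\<And>i. 0 < x i" and "x \<longlonglongrightarrow> 0"
  obtains \<sigma> where "bij \<sigma>" "descending_rearrangement x = x \<circ> \<sigma>"
    "decseq (descending_rearrangement x)"
proof -
  have "\<exists>!p. decseq p \<and> (\<exists>\<sigma>. bij \<sigma> \<and> p = x \<circ> \<sigma>)"
  proof (rule ex_ex1I)
    show "\<exists>p. decseq p \<and> (\<exists>\<sigma>. bij \<sigma> \<and> p = x \<circ> \<sigma>)"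
      using decseq_rearrangement_exists[OF assms] by metis
    fix p q assume p: "decseq p \<and> (\<exists>\<sigma>. bij \<sigma> \<and> p = x \<circ> \<sigma>)"
      and q: "decseq q \<and> (\<exists>\<sigma>. bij \<sigma> \<and> q = x \<circ> \<sigma>)"
    have "t \<le> p k \<longleftrightarrow> t \<le> q k" for t k
      using p q rearrangement_ge_iff[of p _ x t k] rearrangement_ge_iff[of q _ x t k] by auto
    then show "p = q" by (intro ext order_antisym) auto
  qed
  from theI'[OF this] show ?thesis
    using that unfolding descending_rearrangement_def by auto
qed

lemma descending_rearrangement_ge_iff:
  fixes x :: "nat \<Rightarrow> real"
  assumes "\<And>i. 0 < x i" and "x \<longlonglongrightarrow> 0"
  shows "t \<le> descending_rearrangement x k \<longleftrightarrow>
    (\<exists>J. finite J \<and> card J = Suc k \<and> (\<forall>j\<in>J. t \<le> x j))"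
proof -
  obtain \<sigma> where "bij \<sigma>" "descending_rearrangement x = x \<circ> \<sigma>"
    "decseq (descending_rearrangement x)"
    using descending_rearrangement_ex[of x] assms by blast
  then show ?thesis by (metis rearrangement_ge_iff)
qed

text \<open>
  Sorting does not increase the distance in the supremum norm: the first \<open>k + 1\<close> entries of \<open>x\<close> exceed
  \<open>p k - e\<close>, and only the first \<open>k\<close> entries can reach \<open>p k + e\<close>. In the lower bound this makes
  it enough to control the unsorted sticks.
\<close>
lemma descending_rearrangement_nonexpansive:
  fixes x p :: "nat \<Rightarrow> real"
  assumes x: "\<And>i. 0 < x i" "x \<longlonglongrightarrow> 0" and "decseq p"
    and close: "\<And>i. \<bar>x i - p i\<bar> < e"
  shows "\<bar>descending_rearrangement x k - p k\<bar> < e"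
proof -
  note iff = descending_rearrangement_ge_iff[OF x]
  let ?q = "descending_rearrangement x k"
  define m where "m = Min (x ` {..k})"
  have "m \<in> x ` {..k}" unfolding m_def by (intro Min_in) auto
  then obtain i where "i \<le> k" "m = x i" by auto
  then have "p k - e < m" using close[of i] decseqD[OF \<open>decseq p\<close>, of i k] by linarith
  moreover have "m \<le> ?q" unfolding iff
    by (intro exI[of _ "{..k}"]) (auto simp: m_def intro!: Min_le)
  moreover have "\<not> p k + e \<le> ?q"
  proof
    assume "p k + e \<le> ?q"
    then obtain J where J: "finite J" "card J = Suc k" "\<forall>j\<in>J. p k + e \<le> x j"
      unfolding iff by auto
    have "J \<subseteq> {..<k}"
    proof
      fix j assume "j \<in> J"
      then have "p k < p j" using J(3) close[of j] by fastforce
      then show "j \<in> {..<k}" using decseqD[OF \<open>decseq p\<close>, of k j] by (meson lessThan_iff not_le)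
    qed
    then have "card J \<le> k" using card_mono[of "{..<k}" J] by simp
    then show False using J by simp
  qed
  ultimately show ?thesis by linarith
qed

section \<open>Stick breaking\<close>

lemma stick_breaking_sum: "(\<Sum>i<n. stick_breaking u i) = 1 - (\<Prod>i<n. 1 - u i)"
  by (induction n) (simp_all add: stick_breaking_def algebra_simps)

text \<open>
  After \<open>n\<close> breaks, what remains is a rescaled copy of a fresh stick. This self-similarity is what
  both large deviation bounds exploit.
\<close>
lemma stick_breaking_add:
  "stick_breaking u (n + k) = (\<Prod>i<n. 1 - u i) * stick_breaking (\<lambda>i. u (n + i)) k"
proof -
  have "(\<Prod>i<n + k. 1 - u i) = (\<Prod>i<n. 1 - u i) * (\<Prod>i<k. 1 - u (n + i))"
    by (induction k) (simp_all add: mult.assoc)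
  then show ?thesis by (simp add: stick_breaking_def mult.assoc)
qed

context
  fixes u :: "nat \<Rightarrow> real"
  assumes u: "\<And>i. u i \<in> {0<..<1}"
begin

lemma stick_breaking_pos: "0 < stick_breaking u i"
  using u by (auto simp: stick_breaking_def intro!: mult_pos_pos prod_pos)

lemma stick_breaking_sum_le:
  assumes "finite J"
  shows "sum (stick_breaking u) J \<le> 1"
proof -
  obtain n where "J \<subseteq> {..<n}" using assms finite_nat_iff_bounded by blast
  then have "sum (stick_breaking u) J \<le> sum (stick_breaking u) {..<n}"
    by (intro sum_mono2) (auto intro: less_imp_le stick_breaking_pos)
  also have "\<dots> \<le> 1" using u unfolding stick_breaking_sum
    by (auto intro!: prod_nonneg simp: less_imp_le)
  finally show ?thesis .
qed

lemma stick_breaking_lim: "stick_breaking u \<longlonglongrightarrow> 0"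
proof (rule summable_LIMSEQ_zero, rule summableI_nonneg_bounded)
  show "0 \<le> stick_breaking u i" for i using stick_breaking_pos by (rule less_imp_le)
  show "(\<Sum>i<n. stick_breaking u i) \<le> 1" for n by (rule stick_breaking_sum_le) simp
qed

lemmas sorted_sticks_ge_iff =
  descending_rearrangement_ge_iff[OF stick_breaking_pos stick_breaking_lim]

lemma sorted_sticks_ex:
  obtains \<sigma> where "bij \<sigma>"
    "descending_rearrangement (stick_breaking u) = stick_breaking u \<circ> \<sigma>"
    "decseq (descending_rearrangement (stick_breaking u))"
  using descending_rearrangement_ex[OF stick_breaking_pos stick_breaking_lim] by blast

lemma sorted_sticks_in_nabla: "descending_rearrangement (stick_breaking u) \<in> nabla_bar"
proof -
  obtain \<sigma> where \<sigma>: "bij \<sigma>"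
    "descending_rearrangement (stick_breaking u) = stick_breaking u \<circ> \<sigma>"
    "decseq (descending_rearrangement (stick_breaking u))" by (rule sorted_sticks_ex)
  let ?p = "stick_breaking u \<circ> \<sigma>"
  have nn: "0 \<le> ?p i" for i using stick_breaking_pos by (simp add: less_imp_le)
  have bd: "(\<Sum>i<n. ?p i) \<le> 1" for n
  proof -
    have "(\<Sum>i<n. ?p i) = sum (stick_breaking u) (\<sigma> ` {..<n})"
      using \<sigma>(1) by (subst sum.reindex) (auto simp: bij_def inj_on_def)
    also have "\<dots> \<le> 1" by (rule stick_breaking_sum_le) simp
    finally show ?thesis .
  qed
  have "summable ?p" using nn bd by (rule summableI_nonneg_bounded)
  moreover have "suminf ?p \<le> 1" using nn bd by (intro suminf_le_const \<open>summable ?p\<close>)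
  ultimately show ?thesis unfolding nabla_bar_def using \<sigma> nn by auto
qed

end

section \<open>The Beta distribution\<close>

text \<open>
  The derivative is only needed inside the interval: the antiderivatives below contain powers of
  \<open>1 - x\<close> that need not be differentiable at \<open>1\<close>.
\<close>
lemma nn_integral_FTC_Ioo:
  fixes f F :: "real \<Rightarrow> real"
  assumes "a \<le> b" "continuous_on {a..b} F"
    and "\<And>x. x \<in> {a<..<b} \<Longrightarrow> (F has_real_derivative f x) (at x)"
    and "\<And>x. x \<in> {a<..<b} \<Longrightarrow> 0 \<le> f x"
  shows "(\<integral>\<^sup>+x. ennreal (f x) * indicator {a<..<b} x \<partial>lborel) = ennreal (F b - F a)"
proof (rule nn_integral_has_integral_lebesgue')
  have "(f has_integral F b - F a) {a..b}"
    using assms by (intro fundamental_theorem_of_calculus_interior)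
      (auto simp: has_real_derivative_iff_has_vector_derivative)
  then show "(f has_integral F b - F a) {a<..<b}" by (simp add: has_integral_Icc_iff_Ioo)
qed (use assms in auto)

lemma space_beta1: "space (beta1 \<theta>) = {0<..<1}"
  by (simp add: beta1_def space_restrict_space)

lemma sets_beta1: "sets (beta1 \<theta>) = sets (restrict_space borel {0<..<1})"
  unfolding beta1_def sets_density by (rule sets_restrict_space_cong) simp

lemma measurable_ident_beta1: "(\<lambda>x. x) \<in> borel_measurable (beta1 \<theta>)"
  by (subst measurable_cong_sets[OF sets_beta1 refl]) (simp add: measurable_restrict_space1)

lemma nn_integral_beta1:
  assumes [measurable]: "f \<in> borel_measurable borel"
  shows "(\<integral>\<^sup>+x. f x \<partial>beta1 \<theta>) =
    (\<integral>\<^sup>+x. ennreal (\<theta> * (1 - x) powr (\<theta> - 1)) * f x * indicator {0<..<1} x \<partial>lborel)"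
proof -
  have [measurable]: "f \<in> borel_measurable (restrict_space lborel {0<..<1})"
    by (simp add: measurable_restrict_space1)
  have [measurable]: "(\<lambda>x. ennreal (\<theta> * (1 - x) powr (\<theta> - 1))) \<in> borel_measurable (restrict_space lborel {0<..<1::real})"
    by (intro measurable_restrict_space1) measurable
  show ?thesis unfolding beta1_def
    by (subst nn_integral_density) (auto simp: nn_integral_restrict_space)
qed

lemma one_minus_powr_derivative:
  assumes "x < 1"
  shows "((\<lambda>x. - (c * (1 - x) powr q)) has_real_derivative c * (q * (1 - x) powr (q - 1))) (at x)"
proof -
  have "((\<lambda>x. - (c * (1 - x) powr q)) has_real_derivative - (c * (q * (1 - x) powr (q - 1) * (0 - 1)))) (at x)"
    by (rule derivative_eq_intros refl | (use assms in simp))+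
  then show ?thesis by simp
qed

lemma continuous_on_one_minus_powr:
  assumes "0 < q" "b \<le> 1"
  shows "continuous_on {a..b} (\<lambda>x::real. (1 - x) powr q)"
  using assms by (intro continuous_on_powr' continuous_intros) auto

lemma emeasure_beta1_Ioo:
  assumes "0 < \<theta>" "0 \<le> a" "a \<le> b" "b \<le> 1"
  shows "emeasure (beta1 \<theta>) {a<..<b} = ennreal ((1 - a) powr \<theta> - (1 - b) powr \<theta>)"
proof -
  have "{a<..<b} \<in> sets (beta1 \<theta>)"
    using assms unfolding sets_beta1 by (auto simp: sets_restrict_space_iff)
  then have "emeasure (beta1 \<theta>) {a<..<b} = (\<integral>\<^sup>+x. indicator {a<..<b} x \<partial>beta1 \<theta>)" by simp
  also have "\<dots> = (\<integral>\<^sup>+x. ennreal (\<theta> * (1 - x) powr (\<theta> - 1)) * indicator {a<..<b} x \<partial>lborel)"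
    using assms by (subst nn_integral_beta1) (auto simp: indicator_def intro!: nn_integral_cong)
  also have "\<dots> = ennreal (- (1 * (1 - b) powr \<theta>) - (- (1 * (1 - a) powr \<theta>)))"
    using assms one_minus_powr_derivative[of _ 1 \<theta>] by (intro nn_integral_FTC_Ioo)
      (auto intro!: continuous_intros continuous_on_one_minus_powr)
  finally show ?thesis by simp
qed

lemma prob_space_beta1: "0 < \<theta> \<Longrightarrow> prob_space (beta1 \<theta>)"
  by (rule prob_spaceI) (simp add: space_beta1 emeasure_beta1_Ioo)

lemma nn_integral_beta1_powr:
  assumes "0 < \<theta>" "l < \<theta>"
  shows "(\<integral>\<^sup>+x. ennreal ((1 - x) powr (- l)) \<partial>beta1 \<theta>) = ennreal (\<theta> / (\<theta> - l))"
proof -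
  have "(\<integral>\<^sup>+x. ennreal ((1 - x) powr (- l)) \<partial>beta1 \<theta>) =
    (\<integral>\<^sup>+x. ennreal (\<theta> * (1 - x) powr (\<theta> - l - 1)) * indicator {0<..<1} x \<partial>lborel)"
    using assms by (subst nn_integral_beta1)
      (auto simp: ennreal_mult'[symmetric] powr_add[symmetric] algebra_simps intro!: nn_integral_cong)
  also have "\<dots> = ennreal (- (\<theta> / (\<theta> - l) * (1 - 1) powr (\<theta> - l)) - (- (\<theta> / (\<theta> - l) * (1 - 0) powr (\<theta> - l))))"
    using assms one_minus_powr_derivative[of _ "\<theta> / (\<theta> - l)" "\<theta> - l"] by (intro nn_integral_FTC_Ioo)
      (auto intro!: continuous_intros continuous_on_one_minus_powr)
  finally show ?thesis by simp
qed

text \<open>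
  This is the analytic core of the upper bound. Let \<open>1 - x\<close> be the proportion of the stick left by
  one break. Integrating by parts the density \<open>\<theta> * (1 - x) powr (\<theta> - 1)\<close> against
  \<open>h x = (1 - (1 - x) * m) powr (- l)\<close> shows that the integral of \<open>h\<close>, weighted with the
  extra factor \<open>1 + \<rho> * t / (1 - t)\<close> for \<open>t = (1 - x) * m\<close>, is exactly
  \<open>(1 - m) powr (- l)\<close>. Where \<open>t \<ge> d\<close> the factor is at least \<open>1 + \<kappa>\<close>, and where \<open>t < d\<close> the
  integrand \<open>h\<close> is at most \<open>(1 - d) powr (- l)\<close>. Thus a break contracts the moment of order
  \<open>l\<close> by \<open>1 / (1 + \<kappa>)\<close>, up to an additive term that does not depend on \<open>m\<close>. As \<open>l\<close> is proportional to \<open>\<theta>\<close>, the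
  contraction rate \<open>\<kappa>\<close> does not depend on \<open>\<theta>\<close>.
\<close>
lemma nn_integral_beta1_contract:
  assumes "0 < \<theta>" "0 < \<rho>" "0 < d" "d < 1" "0 \<le> m" "m < 1"
  defines "l \<equiv> \<rho> * \<theta>" and "\<kappa> \<equiv> \<rho> * d / (1 - d)"
  shows "(\<integral>\<^sup>+x. ennreal ((1 - (1 - x) * m) powr (- l)) \<partial>beta1 \<theta>) \<le>
    ennreal ((1 - m) powr (- l) / (1 + \<kappa>) + \<kappa> / (1 + \<kappa>) * (1 - d) powr (- l))"
proof -
  let ?w = "\<lambda>x. \<theta> * (1 - x) powr (\<theta> - 1)"
  let ?h = "\<lambda>x. (1 - (1 - x) * m) powr (- l)"
  let ?D = "(1 - d) powr (- l)"
  have \<kappa>: "0 < \<kappa>" and l: "0 < l" using assms by (auto simp: \<kappa>_def l_def)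
  \<comment> \<open>the derivative of \<open>- (1 - x) powr \<theta> * ?h x\<close>\<close>
  define g where "g = (\<lambda>x. ?w x * ?h x * (1 + \<rho> * ((1 - x) * m) / (1 - (1 - x) * m)))"
  have pos: "0 < 1 - (1 - x) * m" if "0 \<le> x" "x \<le> 1" for x
    using assms that by (smt (verit) mult_left_le_one_le)
  have "(\<integral>\<^sup>+x. ennreal (g x) * indicator {0<..<1} x \<partial>lborel) =
      ennreal (- ((1 - 1) powr \<theta> * ?h 1) - (- ((1 - 0) powr \<theta> * ?h 0)))"
  proof (rule nn_integral_FTC_Ioo)
    show "continuous_on {0..1} (\<lambda>x. - ((1 - x) powr \<theta> * ?h x))"
      using assms pos by (intro continuous_intros continuous_on_one_minus_powr) (force simp: less_le)+
    fix x :: real assume x: "x \<in> {0<..<1}"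
    have p: "0 < 1 - (1 - x) * m" using pos[of x] x by auto
    show "0 \<le> g x" using p x assms by (auto simp: g_def intro!: mult_nonneg_nonneg add_nonneg_nonneg divide_nonneg_pos)
    have "((\<lambda>x. 1 - (1 - x) * m) has_real_derivative m) (at x)"
      by (auto intro!: derivative_eq_intros)
    from DERIV_fun_powr[OF this p, of "- l"]
    have "(?h has_real_derivative - l * (1 - (1 - x) * m) powr (- l - 1) * m) (at x)" by simp
    from DERIV_mult[OF one_minus_powr_derivative[of x 1 \<theta>] this] x
    have "((\<lambda>x. - ((1 - x) powr \<theta> * ?h x)) has_real_derivative
       \<theta> * (1 - x) powr (\<theta> - 1) * ?h x + (1 - x) powr \<theta> * (l * (1 - (1 - x) * m) powr (- l - 1) * m)) (at x)"
      by (simp add: algebra_simps)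
    also have "\<theta> * (1 - x) powr (\<theta> - 1) * ?h x + (1 - x) powr \<theta> * (l * (1 - (1 - x) * m) powr (- l - 1) * m) = g x"
      using p x unfolding g_def l_def by (simp add: powr_diff field_simps)
    finally show "((\<lambda>x. - ((1 - x) powr \<theta> * ?h x)) has_real_derivative g x) (at x)" .
  qed simp
  then have total: "(\<integral>\<^sup>+x. ennreal (g x) * indicator {0<..<1} x \<partial>lborel) = ennreal ((1 - m) powr (- l))"
    by simp
  have bound: "?h x \<le> (?h x * (1 + \<rho> * ((1 - x) * m) / (1 - (1 - x) * m))) / (1 + \<kappa>) + \<kappa> / (1 + \<kappa>) * ?D"
    if x: "x \<in> {0<..<1}" for x
  proof -
    have p: "0 < 1 - (1 - x) * m" using pos[of x] x by auto
    have "(1 + \<kappa>) * ?h x \<le> ?h x * (1 + \<rho> * ((1 - x) * m) / (1 - (1 - x) * m)) + \<kappa> * ?D"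
    proof (cases "d \<le> (1 - x) * m")
      case True
      have "d / (1 - d) \<le> ((1 - x) * m) / (1 - (1 - x) * m)"
        using True p assms by (intro frac_le) auto
      then have "\<kappa> \<le> \<rho> * ((1 - x) * m) / (1 - (1 - x) * m)"
        using \<open>0 < \<rho>\<close> unfolding \<kappa>_def
        by (simp only: times_divide_eq_right[symmetric] mult_left_mono less_imp_le)
      then have "?h x * (1 + \<kappa>) \<le> ?h x * (1 + \<rho> * ((1 - x) * m) / (1 - (1 - x) * m))"
        by (intro mult_left_mono) auto
      moreover have "0 \<le> \<kappa> * ?D" using \<kappa> by simp
      ultimately show ?thesis by (simp add: mult.commute)
    next
      case False
      then have "?h x \<le> ?D" using l assms by (intro powr_mono2') auto
      then have "\<kappa> * ?h x \<le> \<kappa> * ?D" using \<kappa> by simp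
      moreover have "0 \<le> ?h x * (\<rho> * ((1 - x) * m) / (1 - (1 - x) * m))"
        using p x assms by (intro mult_nonneg_nonneg divide_nonneg_pos) auto
      ultimately show ?thesis by (simp add: algebra_simps)
    qed
    moreover have "h \<le> X / (1 + \<kappa>) + \<kappa> / (1 + \<kappa>) * D" if "(1 + \<kappa>) * h \<le> X + \<kappa> * D" for h X D
    proof -
      have "h \<le> (X + \<kappa> * D) / (1 + \<kappa>)" using that \<kappa> by (simp add: pos_le_divide_eq mult.commute)
      then show ?thesis by (simp add: add_divide_distrib)
    qed
    ultimately show ?thesis by blast
  qed
  have [measurable]: "g \<in> borel_measurable borel" unfolding g_def by measurable
  have w1: "(\<integral>\<^sup>+x. ennreal (?w x) * indicator {0<..<1} x \<partial>lborel) = 1"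
    using nn_integral_beta1[of "\<lambda>_. 1" \<theta>] prob_space.emeasure_space_1[OF prob_space_beta1[OF \<open>0 < \<theta>\<close>]]
    by simp
  have "(\<integral>\<^sup>+x. ennreal (?h x) \<partial>beta1 \<theta>) =
      (\<integral>\<^sup>+x. ennreal (?w x) * ennreal (?h x) * indicator {0<..<1} x \<partial>lborel)"
    by (rule nn_integral_beta1) measurable
  also have "\<dots> \<le> (\<integral>\<^sup>+x. ennreal (1 / (1 + \<kappa>)) * (ennreal (g x) * indicator {0<..<1} x) +
      ennreal (\<kappa> / (1 + \<kappa>) * ?D) * (ennreal (?w x) * indicator {0<..<1} x) \<partial>lborel)"
  proof (intro nn_integral_mono)
    fix x :: real
    show "ennreal (?w x) * ennreal (?h x) * indicator {0<..<1} x \<le>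
      ennreal (1 / (1 + \<kappa>)) * (ennreal (g x) * indicator {0<..<1} x) +
      ennreal (\<kappa> / (1 + \<kappa>) * ?D) * (ennreal (?w x) * indicator {0<..<1} x)"
    proof (cases "x \<in> {0<..<1}")
      case True
      have "?w x * ?h x \<le> ?w x * ((?h x * (1 + \<rho> * ((1 - x) * m) / (1 - (1 - x) * m))) / (1 + \<kappa>) + \<kappa> / (1 + \<kappa>) * ?D)"
        using bound[OF True] assms by (intro mult_left_mono) auto
      also have "\<dots> = 1 / (1 + \<kappa>) * g x + \<kappa> / (1 + \<kappa>) * ?D * ?w x"
      proof -
        have "v * (h * y / (1 + \<kappa>) + c * D) = 1 / (1 + \<kappa>) * (v * h * y) + c * D * v" for v h y c D
          by (simp add: algebra_simps)
        then show ?thesis unfolding g_def by blast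
      qed
      finally have *: "?w x * ?h x \<le> 1 / (1 + \<kappa>) * g x + \<kappa> / (1 + \<kappa>) * ?D * ?w x" .
      have "0 \<le> g x" using pos[of x] True assms
        by (auto simp: g_def intro!: mult_nonneg_nonneg add_nonneg_nonneg divide_nonneg_pos)
      then show ?thesis using True \<kappa> assms *
        by (simp add: ennreal_mult'[symmetric] ennreal_plus[symmetric] del: ennreal_plus)
    qed simp
  qed
  also have "\<dots> = ennreal (1 / (1 + \<kappa>)) * ennreal ((1 - m) powr (- l)) + ennreal (\<kappa> / (1 + \<kappa>) * ?D)"
    by (subst nn_integral_add; (subst nn_integral_cmult)?) (simp_all add: total w1 nn_integral_cmult)
  also have "\<dots> = ennreal ((1 - m) powr (- l) / (1 + \<kappa>) + \<kappa> / (1 + \<kappa>) * ?D)"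
    using \<kappa> by (simp add: ennreal_mult'[symmetric] ennreal_plus[symmetric] del: ennreal_plus)
  finally show ?thesis .
qed

section \<open>The infinite product and its self-similarity\<close>

abbreviation sticks :: "real \<Rightarrow> (nat \<Rightarrow> real) measure" where
  "sticks \<theta> \<equiv> Pi\<^sub>M UNIV (\<lambda>_. beta1 \<theta>)"

lemma space_sticks: "u \<in> space (sticks \<theta>) \<longleftrightarrow> (\<forall>i. u i \<in> {0<..<1})"
  by (auto simp: space_PiM space_beta1 PiE_def Pi_def)

lemma sequence_space_beta1:
  assumes "0 < \<theta>"
  shows "sequence_space (beta1 \<theta>)"
proof -
  interpret prob_space "beta1 \<theta>" using assms by (rule prob_space_beta1)
  show ?thesis by unfold_locales
qed

lemma prob_space_sticks: "0 < \<theta> \<Longrightarrow> prob_space (sticks \<theta>)"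
  by (intro prob_space_PiM prob_space_beta1)

lemma measurable_sticks_component: "(\<lambda>u. u i) \<in> borel_measurable (sticks \<theta>)"
  using measurable_compose[OF measurable_component_singleton[of i UNIV "\<lambda>_. beta1 \<theta>"]
      measurable_ident_beta1[of \<theta>]] by simp

text \<open>
  Conditioning on the first break: the later ones are again an independent copy of the whole
  sequence. The first break is integrated on the inside, because its integral is the one that is
  estimated for fixed later breaks.
\<close>
lemma nn_integral_sticks:
  assumes "0 < \<theta>" and [measurable]: "f \<in> borel_measurable (sticks \<theta>)"
  shows "(\<integral>\<^sup>+u. f u \<partial>sticks \<theta>) = (\<integral>\<^sup>+w. \<integral>\<^sup>+s. f (case_nat s w) \<partial>beta1 \<theta> \<partial>sticks \<theta>)"
proof -
  interpret B: prob_space "beta1 \<theta>" using assms by (intro prob_space_beta1)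
  interpret S: prob_space "sticks \<theta>" using assms by (intro prob_space_sticks)
  interpret sequence_space "beta1 \<theta>" using assms by (intro sequence_space_beta1)
  interpret P: pair_sigma_finite "beta1 \<theta>" "sticks \<theta>" ..
  have "(\<integral>\<^sup>+u. f u \<partial>sticks \<theta>) = (\<integral>\<^sup>+u. f u \<partial>distr (beta1 \<theta> \<Otimes>\<^sub>M sticks \<theta>) (sticks \<theta>) (\<lambda>(s, w). case_nat s w))"
    by (simp add: PiM_iter)
  also have "\<dots> = (\<integral>\<^sup>+z. f (case z of (s, w) \<Rightarrow> case_nat s w) \<partial>(beta1 \<theta> \<Otimes>\<^sub>M sticks \<theta>))"
    by (rule nn_integral_distr) measurable
  also have "\<dots> = (\<integral>\<^sup>+w. \<integral>\<^sup>+s. f (case_nat s w) \<partial>beta1 \<theta> \<partial>sticks \<theta>)"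
    by (subst P.nn_integral_snd[symmetric]) simp_all
  finally show ?thesis .
qed

section \<open>Exponential moments of the largest sticks\<close>

text \<open>
  The largest sum of at most \<open>n\<close> of the first \<open>k\<close> sticks. The recursion decides whether the first stick
  is among the chosen ones; restricting to finitely many sticks gives a quantity on which one can
  induct.
\<close>
fun top_sum :: "nat \<Rightarrow> nat \<Rightarrow> (nat \<Rightarrow> real) \<Rightarrow> real" where
  "top_sum k 0 u = 0"
| "top_sum 0 (Suc n) u = 0"
| "top_sum (Suc k) (Suc n) u =
    max ((1 - u 0) * top_sum k (Suc n) (\<lambda>i. u (Suc i))) (u 0 + (1 - u 0) * top_sum k n (\<lambda>i. u (Suc i)))"

lemma measurable_top_sum:
  assumes "\<And>i. (\<lambda>x. f x i) \<in> borel_measurable M"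
  shows "(\<lambda>x. top_sum k n (f x)) \<in> borel_measurable M"
  using assms
proof (induction k n "\<lambda>i::nat. 0::real" arbitrary: f rule: top_sum.induct)
  case (3 k n)
  have [measurable]: "(\<lambda>x. top_sum k (Suc n) (\<lambda>i. f x (Suc i))) \<in> borel_measurable M"
    "(\<lambda>x. top_sum k n (\<lambda>i. f x (Suc i))) \<in> borel_measurable M"
    by (rule 3; rule 3)+
  have [measurable]: "(\<lambda>x. f x 0) \<in> borel_measurable M" by (rule 3)
  show ?case unfolding top_sum.simps by measurable
qed simp_all

lemma top_sum_bounds:
  assumes "\<And>i. u i \<in> {0<..<1}"
  shows "0 \<le> top_sum k n u \<and> top_sum k n u < 1"
  using assms
proof (induction k n u rule: top_sum.induct)
  case (3 k n u)
  let ?a = "top_sum k (Suc n) (\<lambda>i. u (Suc i))" and ?b = "top_sum k n (\<lambda>i. u (Suc i))"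
  have u: "0 < u 0" "u 0 < 1" using 3(3)[of 0] by auto
  have a: "0 \<le> ?a" "?a < 1" and b: "0 \<le> ?b" "?b < 1" using 3 by auto
  have "(1 - u 0) * ?a < 1" using u a by (smt (verit) mult_left_le_one_le)
  moreover have "(1 - u 0) * ?b < (1 - u 0) * 1" using u b by (intro mult_strict_left_mono) auto
  moreover have "0 \<le> (1 - u 0) * ?a" using u a by simp
  ultimately show ?case by simp
qed simp_all

lemma top_sum_mono:
  assumes "\<And>i. u i \<in> {0<..<1}"
  shows "top_sum k n u \<le> top_sum (Suc k) n u"
  using assms
proof (induction k n u rule: top_sum.induct)
  case (2 n u)
  have "0 \<le> top_sum (Suc 0) (Suc n) u" using top_sum_bounds 2 by blast
  then show ?case by simp
next
  case (3 k n u)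
  have u: "0 \<le> 1 - u 0" using 3(3)[of 0] by auto
  show ?case
    by (subst (1 2) top_sum.simps(3), intro max.mono add_left_mono mult_left_mono u 3)
qed simp

lemma stick_sum_le_top_sum:
  assumes "\<And>i. u i \<in> {0<..<1}" "J \<subseteq> {..<k}" "card J \<le> n"
  shows "sum (stick_breaking u) J \<le> top_sum k n u"
  using assms
proof (induction k n u arbitrary: J rule: top_sum.induct)
  case (1 k u)
  then have "J = {}" using finite_subset by fastforce
  then show ?case by simp
next
  case (3 k n u)
  let ?v = "\<lambda>i. u (Suc i)"
  define J' where "J' = {j. Suc j \<in> J}"
  have fin: "finite J" using 3 finite_subset by blast
  have J': "J' \<subseteq> {..<k}" using 3(4) by (auto simp: J'_def)
  then have fin': "finite J'" by (rule finite_subset) simp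
  have split: "J = (if 0 \<in> J then insert 0 (Suc ` J') else Suc ` J')"
    unfolding J'_def by (auto simp: image_iff) (metis not0_implies_Suc)+
  have u: "0 \<le> 1 - u 0" using 3(3)[of 0] by auto
  have tail: "sum (stick_breaking u) (Suc ` J') = (1 - u 0) * sum (stick_breaking ?v) J'"
    using stick_breaking_add[of u 1] by (simp add: sum.reindex sum_distrib_left)
  have u0: "stick_breaking u 0 = u 0" by (simp add: stick_breaking_def)
  show ?case
  proof (cases "0 \<in> J")
    case True
    then have eq: "J = insert 0 (Suc ` J')" using split by simp
    then have "card J = Suc (card J')" using fin' by (simp add: card_image)
    then have "card J' \<le> n" using 3(5) by simp
    then have "sum (stick_breaking ?v) J' \<le> top_sum k n ?v" using 3 J' by auto
    then have "(1 - u 0) * sum (stick_breaking ?v) J' \<le> (1 - u 0) * top_sum k n ?v"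
      using u by (rule mult_left_mono)
    moreover have "sum (stick_breaking u) J = u 0 + (1 - u 0) * sum (stick_breaking ?v) J'"
      using fin' by (subst eq) (simp add: tail u0)
    ultimately show ?thesis by simp
  next
    case False
    then have eq: "J = Suc ` J'" using split by simp
    then have "card J' \<le> Suc n" using 3(5) by (simp add: card_image)
    then have "sum (stick_breaking ?v) J' \<le> top_sum k (Suc n) ?v" using 3 J' by auto
    then have "(1 - u 0) * sum (stick_breaking ?v) J' \<le> (1 - u 0) * top_sum k (Suc n) ?v"
      using u by (rule mult_left_mono)
    then show ?thesis using tail by (subst eq) simp
  qed
qed simp

text \<open>
  Induction along the recursion of \<open>top_sum\<close>. If the first stick is not chosen, the moment for
  \<open>(k, n + 1)\<close> reappears, contracted by \<open>1 - w = 1 / (1 + \<kappa>)\<close> thanks to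
  \<open>nn_integral_beta1_contract\<close>; if it is chosen, the factor \<open>1 - x\<close> splits off and contributes
  \<open>\<theta> / (\<theta> - l) = 1 / (1 - \<rho>)\<close> times the moment for \<open>(k, n)\<close>. The bound is uniform in \<open>k\<close>,
  and the base of the power \<open>n\<close> is chosen so that it reproduces itself in this recursion; it depends
  on \<open>\<rho>\<close> and \<open>d\<close> but not on \<open>\<theta>\<close>.
\<close>
lemma top_sum_moment:
  assumes "0 < \<theta>" "0 < \<rho>" "\<rho> < 1" "0 < d" "d < 1"
  defines "l \<equiv> \<rho> * \<theta>" and "w \<equiv> (\<rho> * d / (1 - d)) / (1 + \<rho> * d / (1 - d))"
  shows "(\<integral>\<^sup>+u. ennreal ((1 - top_sum k n u) powr (- l)) \<partial>sticks \<theta>) \<le>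
    ennreal ((1 - d) powr (- l) * (1 + 1 / ((1 - \<rho>) * w)) ^ n)"
proof -
  interpret S: prob_space "sticks \<theta>" using assms by (intro prob_space_sticks)
  define C where "C = 1 + 1 / ((1 - \<rho>) * w)"
  let ?D = "(1 - d) powr (- l)"
  have w: "0 < w" using assms unfolding w_def by (intro divide_pos_pos add_pos_pos) auto
  have w': "1 / (1 + \<rho> * d / (1 - d)) = 1 - w"
  proof -
    have "1 / (1 + \<kappa>) = 1 - \<kappa> / (1 + \<kappa>)" if "0 < \<kappa>" for \<kappa> :: real
      using that by (simp add: field_simps)
    moreover have "0 < \<rho> * d / (1 - d)" using assms by simp
    ultimately show ?thesis unfolding w_def by blast
  qed
  have l: "0 < l" "l < \<theta>" using assms by (auto simp: l_def)
  have C: "1 \<le> C" using w assms by (simp add: C_def)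
  \<comment> \<open>This identity dictates the choice of \<open>C\<close>.\<close>
  have Cw: "C * w = w + 1 / (1 - \<rho>)" using w \<open>\<rho> < 1\<close> unfolding C_def by (simp add: field_simps)
  have "(1 - d) powr l \<le> 1 powr l" using assms l by (intro powr_mono2) auto
  then have D: "1 \<le> ?D" using assms by (simp add: powr_minus one_le_inverse)
  note [measurable] = measurable_top_sum[OF measurable_sticks_component]
  have base: "(\<integral>\<^sup>+u. ennreal ((1 - 0) powr (- l)) \<partial>sticks \<theta>) \<le> ennreal (?D * C ^ n)" for n
  proof -
    have "1 * 1 \<le> ?D * C ^ n" using D C by (intro mult_mono one_le_power) auto
    then show ?thesis by (simp add: S.emeasure_space_1)
  qed
  have "(\<integral>\<^sup>+u. ennreal ((1 - top_sum k n u) powr (- l)) \<partial>sticks \<theta>) \<le> ennreal (?D * C ^ n)"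
  proof (induction k n "\<lambda>i::nat. 0::real" rule: top_sum.induct)
    case (3 k n)
    let ?E = "\<lambda>k n. \<integral>\<^sup>+u. ennreal ((1 - top_sum k n u) powr (- l)) \<partial>sticks \<theta>"
    have "?E (Suc k) (Suc n) =
        (\<integral>\<^sup>+v. \<integral>\<^sup>+s. ennreal ((1 - top_sum (Suc k) (Suc n) (case_nat s v)) powr (- l)) \<partial>beta1 \<theta> \<partial>sticks \<theta>)"
      using assms by (intro nn_integral_sticks) measurable
    also have "\<dots> \<le> (\<integral>\<^sup>+v. ennreal (1 - w) * ennreal ((1 - top_sum k (Suc n) v) powr (- l)) +
        (ennreal (w * ?D) + ennreal (1 / (1 - \<rho>)) * ennreal ((1 - top_sum k n v) powr (- l))) \<partial>sticks \<theta>)"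
    proof (intro nn_integral_mono)
      fix v assume "v \<in> space (sticks \<theta>)"
      then have v: "\<And>i. v i \<in> {0<..<1}" by (simp add: space_sticks)
      let ?a = "top_sum k (Suc n) v" and ?b = "top_sum k n v"
      have a: "0 \<le> ?a" "?a < 1" and b: "0 \<le> ?b" "?b < 1" using top_sum_bounds[OF v] by auto
      have "(\<integral>\<^sup>+s. ennreal ((1 - top_sum (Suc k) (Suc n) (case_nat s v)) powr (- l)) \<partial>beta1 \<theta>) \<le>
        (\<integral>\<^sup>+s. ennreal ((1 - (1 - s) * ?a) powr (- l)) +
          ennreal ((1 - ?b) powr (- l)) * ennreal ((1 - s) powr (- l)) \<partial>beta1 \<theta>)"
      proof (intro nn_integral_mono)
        fix s assume "s \<in> space (beta1 \<theta>)"
        then have s: "0 < s" "s < 1" by (auto simp: space_beta1)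
        have "1 - (s + (1 - s) * ?b) = (1 - ?b) * (1 - s)" by (simp add: algebra_simps)
        then have "(1 - (s + (1 - s) * ?b)) powr (- l) = (1 - ?b) powr (- l) * (1 - s) powr (- l)"
          using s b by (simp add: powr_mult)
        then have "(1 - top_sum (Suc k) (Suc n) (case_nat s v)) powr (- l) \<le>
          (1 - (1 - s) * ?a) powr (- l) + (1 - ?b) powr (- l) * (1 - s) powr (- l)"
          by (simp add: max_def)
        then show "ennreal ((1 - top_sum (Suc k) (Suc n) (case_nat s v)) powr (- l)) \<le>
          ennreal ((1 - (1 - s) * ?a) powr (- l)) + ennreal ((1 - ?b) powr (- l)) * ennreal ((1 - s) powr (- l))"
          by (simp add: ennreal_mult'[symmetric] ennreal_plus[symmetric] del: ennreal_plus)
      qed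
      also have "\<dots> = (\<integral>\<^sup>+s. ennreal ((1 - (1 - s) * ?a) powr (- l)) \<partial>beta1 \<theta>) +
          ennreal ((1 - ?b) powr (- l)) * ennreal (\<theta> / (\<theta> - l))"
      proof -
        have m: "(\<lambda>s. ennreal ((1 - (1 - s) * ?a) powr (- l))) \<in> borel_measurable (beta1 \<theta>)"
          "(\<lambda>s. ennreal ((1 - s) powr (- l))) \<in> borel_measurable (beta1 \<theta>)"
          by (rule measurable_compose[OF measurable_ident_beta1]; measurable)+
        show ?thesis using m assms l
          by (simp add: nn_integral_add nn_integral_cmult nn_integral_beta1_powr)
      qed
      also have "\<dots> \<le> ennreal ((1 - w) * (1 - ?a) powr (- l) + w * ?D) +
          ennreal ((1 - ?b) powr (- l)) * ennreal (\<theta> / (\<theta> - l))"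
      proof (intro add_right_mono)
        have "(\<integral>\<^sup>+s. ennreal ((1 - (1 - s) * ?a) powr (- l)) \<partial>beta1 \<theta>) \<le>
          ennreal ((1 - ?a) powr (- l) / (1 + \<rho> * d / (1 - d)) + w * ?D)"
          using nn_integral_beta1_contract[of \<theta> \<rho> d ?a] assms a by simp
        moreover have "(1 - ?a) powr (- l) / (1 + \<rho> * d / (1 - d)) = (1 - w) * (1 - ?a) powr (- l)"
          by (simp add: w'[symmetric])
        ultimately show "(\<integral>\<^sup>+s. ennreal ((1 - (1 - s) * ?a) powr (- l)) \<partial>beta1 \<theta>) \<le>
          ennreal ((1 - w) * (1 - ?a) powr (- l) + w * ?D)" by simp
      qed
      also have "\<theta> / (\<theta> - l) = 1 / (1 - \<rho>)" using assms by (simp add: l_def field_simps)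
      also have "ennreal ((1 - w) * (1 - ?a) powr (- l) + w * ?D) +
          ennreal ((1 - ?b) powr (- l)) * ennreal (1 / (1 - \<rho>)) =
        ennreal (1 - w) * ennreal ((1 - ?a) powr (- l)) +
          (ennreal (w * ?D) + ennreal (1 / (1 - \<rho>)) * ennreal ((1 - ?b) powr (- l)))"
      proof -
        have "0 \<le> 1 - w" unfolding w'[symmetric] using assms by simp
        then show ?thesis using w assms
          by (simp add: ennreal_mult'[symmetric] ennreal_plus[symmetric] mult.commute add.assoc del: ennreal_plus)
      qed
      finally show "(\<integral>\<^sup>+s. ennreal ((1 - top_sum (Suc k) (Suc n) (case_nat s v)) powr (- l)) \<partial>beta1 \<theta>) \<le>
          ennreal (1 - w) * ennreal ((1 - ?a) powr (- l)) +
          (ennreal (w * ?D) + ennreal (1 / (1 - \<rho>)) * ennreal ((1 - ?b) powr (- l)))" .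
    qed
    also have "\<dots> = ennreal (1 - w) * ?E k (Suc n) + (ennreal (w * ?D) + ennreal (1 / (1 - \<rho>)) * ?E k n)"
      by (simp add: nn_integral_add nn_integral_cmult S.emeasure_space_1)
    also have "\<dots> \<le> ennreal (1 - w) * ennreal (?D * C ^ Suc n) +
        (ennreal (w * ?D) + ennreal (1 / (1 - \<rho>)) * ennreal (?D * C ^ n))"
      by (intro add_mono mult_left_mono order_refl 3) auto
    also have "\<dots> = ennreal ((1 - w) * (?D * C ^ Suc n) + (w * ?D + 1 / (1 - \<rho>) * (?D * C ^ n)))"
    proof -
      have "0 \<le> 1 - w" unfolding w'[symmetric] using assms by simp
      then show ?thesis using w assms C
        by (simp add: ennreal_mult'[symmetric] ennreal_plus[symmetric] del: ennreal_plus power_Suc)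
    qed
    also have "\<dots> \<le> ennreal (?D * C ^ Suc n)"
    proof (rule ennreal_leI)
      have "w * 1 \<le> w * C ^ n" using w C by (intro mult_left_mono one_le_power) auto
      then have "w + 1 / (1 - \<rho>) * C ^ n \<le> (C * w) * C ^ n" by (simp add: Cw algebra_simps)
      then have "?D * (w + 1 / (1 - \<rho>) * C ^ n) \<le> ?D * ((C * w) * C ^ n)" by (rule mult_left_mono) simp
      then show "(1 - w) * (?D * C ^ Suc n) + (w * ?D + 1 / (1 - \<rho>) * (?D * C ^ n)) \<le> ?D * C ^ Suc n"
        by (simp add: algebra_simps)
    qed
    finally show ?case .
  qed (simp_all only: top_sum.simps base)
  then show ?thesis by (simp add: C_def)
qed

text \<open>
  Markov's inequality for the moment above, followed by continuity from below in \<open>k\<close>. With \<open>n\<close> fixed,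
  \<open>\<rho>\<close> near \<open>1\<close> and \<open>d\<close> near \<open>0\<close>, the exponential rate in \<open>\<theta>\<close> approaches \<open>ln (1 - a)\<close>.
\<close>
lemma top_sum_tail:
  assumes "0 < \<theta>" "0 < \<rho>" "\<rho> < 1" "0 < d" "d < 1" "0 \<le> a" "a < 1"
  defines "w \<equiv> (\<rho> * d / (1 - d)) / (1 + \<rho> * d / (1 - d))"
  shows "measure (sticks \<theta>) {u \<in> space (sticks \<theta>). \<exists>k. a \<le> top_sum k n u} \<le>
    (1 + 1 / ((1 - \<rho>) * w)) ^ n * ((1 - a) / (1 - d)) powr (\<rho> * \<theta>)"
proof -
  interpret S: prob_space "sticks \<theta>" using assms by (intro prob_space_sticks)
  define l where "l = \<rho> * \<theta>"
  have l: "0 < l" using assms by (simp add: l_def)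
  let ?C = "1 + 1 / ((1 - \<rho>) * w)"
  let ?A = "\<lambda>k. {u \<in> space (sticks \<theta>). a \<le> top_sum k n u}"
  have w: "0 < w" using assms unfolding w_def by (intro divide_pos_pos add_pos_pos) auto
  note [measurable] = measurable_top_sum[OF measurable_sticks_component]
  have A: "range ?A \<subseteq> sets (sticks \<theta>)" by (auto, measurable)
  have bound: "measure (sticks \<theta>) (?A k) \<le> ?C ^ n * ((1 - a) / (1 - d)) powr l" for k
  proof -
    let ?f = "\<lambda>u. ennreal ((1 - top_sum k n u) powr (- l))"
    have "emeasure (sticks \<theta>) (?A k) \<le>
      emeasure (sticks \<theta>) {u \<in> space (sticks \<theta>). 1 \<le> ennreal ((1 - a) powr l) * ?f u}"
    proof (intro emeasure_mono)
      show "?A k \<subseteq> {u \<in> space (sticks \<theta>). 1 \<le> ennreal ((1 - a) powr l) * ?f u}"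
      proof safe
        fix u assume u: "u \<in> space (sticks \<theta>)" "a \<le> top_sum k n u"
        then have "top_sum k n u < 1" using top_sum_bounds by (simp add: space_sticks)
        then have "(1 - a) powr (- l) \<le> (1 - top_sum k n u) powr (- l)"
          using u l by (intro powr_mono2') auto
        then have "(1 - a) powr l * (1 - a) powr (- l) \<le> (1 - a) powr l * (1 - top_sum k n u) powr (- l)"
          by (rule mult_left_mono) simp
        then have "1 \<le> (1 - a) powr l * (1 - top_sum k n u) powr (- l)"
          using assms by (simp add: powr_add[symmetric])
        then show "1 \<le> ennreal ((1 - a) powr l) * ?f u"
          by (simp add: ennreal_mult'[symmetric])
      qed
    qed measurable
    also have "\<dots> \<le> ennreal ((1 - a) powr l) * (\<integral>\<^sup>+u. ?f u * indicator (space (sticks \<theta>)) u \<partial>sticks \<theta>)"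
      by (rule nn_integral_Markov_inequality) measurable
    also have "(\<integral>\<^sup>+u. ?f u * indicator (space (sticks \<theta>)) u \<partial>sticks \<theta>) = (\<integral>\<^sup>+u. ?f u \<partial>sticks \<theta>)"
      by (intro nn_integral_cong) simp
    also have "ennreal ((1 - a) powr l) * \<dots> \<le> ennreal ((1 - a) powr l) * ennreal ((1 - d) powr (- l) * ?C ^ n)"
      unfolding l_def w_def using assms by (intro mult_left_mono top_sum_moment) auto
    also have "\<dots> = ennreal (?C ^ n * ((1 - a) / (1 - d)) powr l)"
      using assms by (simp add: ennreal_mult'[symmetric] powr_divide powr_minus field_simps)
    finally have "emeasure (sticks \<theta>) (?A k) \<le> ennreal (?C ^ n * ((1 - a) / (1 - d)) powr l)" .
    then show ?thesis using w assms by (simp add: S.emeasure_eq_measure ennreal_le_iff)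
  qed
  have "incseq ?A"
  proof (intro incseq_SucI subsetI)
    fix k u assume "u \<in> ?A k"
    then show "u \<in> ?A (Suc k)" using top_sum_mono[of u k n] by (auto simp: space_sticks)
  qed
  with A have "(\<lambda>k. measure (sticks \<theta>) (?A k)) \<longlonglongrightarrow> measure (sticks \<theta>) (\<Union>k. ?A k)"
    by (intro S.finite_Lim_measure_incseq) auto
  then have "measure (sticks \<theta>) (\<Union>k. ?A k) \<le> ?C ^ n * ((1 - a) / (1 - d)) powr l"
    by (rule LIMSEQ_le_const2) (use bound in auto)
  moreover have "(\<Union>k. ?A k) = {u \<in> space (sticks \<theta>). \<exists>k. a \<le> top_sum k n u}" by auto
  ultimately show ?thesis by (simp add: l_def)
qed

section \<open>The Poisson--Dirichlet law\<close>

lemma measurable_stick_breaking: "(\<lambda>u. stick_breaking u j) \<in> borel_measurable (sticks \<theta>)"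
proof -
  note [measurable] = measurable_sticks_component
  show ?thesis unfolding stick_breaking_def by measurable
qed

lemma measurable_sorted_sticks:
  "(\<lambda>u. descending_rearrangement (stick_breaking u)) \<in> measurable (sticks \<theta>) (restrict_space borel nabla_bar)"
proof (rule measurable_restrict_space2)
  show "(\<lambda>u. descending_rearrangement (stick_breaking u)) \<in> space (sticks \<theta>) \<rightarrow> nabla_bar"
    using sorted_sticks_in_nabla by (auto simp: space_sticks)
  show "(\<lambda>u. descending_rearrangement (stick_breaking u)) \<in> borel_measurable (sticks \<theta>)"
  proof (rule measurable_coordinatewise_then_product)
    fix k
    note [measurable] = measurable_stick_breaking
    have "{u \<in> space (sticks \<theta>). t \<le> descending_rearrangement (stick_breaking u) k} \<in> sets (sticks \<theta>)" for t
    proof -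
      have "{u \<in> space (sticks \<theta>). t \<le> descending_rearrangement (stick_breaking u) k} =
        (\<Union>J\<in>{J. finite J \<and> card J = Suc k}. {u \<in> space (sticks \<theta>). \<forall>j\<in>J. t \<le> stick_breaking u j})"
        by (auto simp: sorted_sticks_ge_iff space_sticks)
      also have "\<dots> \<in> sets (sticks \<theta>)"
      proof (rule sets.countable_UN'')
        show "countable {J :: nat set. finite J \<and> card J = Suc k}"
          by (rule countable_subset[OF _ countable_Collect_finite]) auto
        show "{u \<in> space (sticks \<theta>). \<forall>j\<in>J. t \<le> stick_breaking u j} \<in> sets (sticks \<theta>)"
          if "J \<in> {J. finite J \<and> card J = Suc k}" for J :: "nat set"
          using that by (intro sets.sets_Collect_finite_All') auto
      qed
      finally show ?thesis .
    qed
    then show "(\<lambda>u. descending_rearrangement (stick_breaking u) k) \<in> borel_measurable (sticks \<theta>)"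
      unfolding borel_measurable_iff_ge by blast
  qed
qed

lemma space_poisson_dirichlet: "space (poisson_dirichlet \<theta>) = nabla_bar"
  by (simp add: poisson_dirichlet_def space_restrict_space)

lemma sets_poisson_dirichlet: "sets (poisson_dirichlet \<theta>) = sets (restrict_space borel nabla_bar)"
  by (simp add: poisson_dirichlet_def)

lemma prob_space_poisson_dirichlet: "0 < \<theta> \<Longrightarrow> prob_space (poisson_dirichlet \<theta>)"
  unfolding poisson_dirichlet_def
  by (intro prob_space.prob_space_distr prob_space_sticks measurable_sorted_sticks)

lemma measure_poisson_dirichlet:
  assumes "A \<in> sets (restrict_space borel nabla_bar)"
  shows "measure (poisson_dirichlet \<theta>) A =
    measure (sticks \<theta>) {u \<in> space (sticks \<theta>). descending_rearrangement (stick_breaking u) \<in> A}"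
  unfolding poisson_dirichlet_def using assms
  by (subst measure_distr[OF measurable_sorted_sticks]) (auto intro!: arg_cong[where f="measure _"])

text \<open>
  The sum of the \<open>n\<close> largest sticks is the sum of some \<open>n\<close> sticks, hence bounded by \<open>top_sum k n\<close> once
  \<open>k\<close> exceeds all the indices involved.
\<close>
lemma poisson_dirichlet_tail:
  assumes "0 < \<theta>" "0 < \<rho>" "\<rho> < 1" "0 < d" "d < 1" "0 \<le> a" "a < 1"
    and F: "F \<in> sets (restrict_space borel nabla_bar)" "\<And>p. p \<in> F \<Longrightarrow> a \<le> (\<Sum>i<n. p i)"
  defines "w \<equiv> (\<rho> * d / (1 - d)) / (1 + \<rho> * d / (1 - d))"
  shows "measure (poisson_dirichlet \<theta>) F \<le>
    (1 + 1 / ((1 - \<rho>) * w)) ^ n * ((1 - a) / (1 - d)) powr (\<rho> * \<theta>)"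
proof -
  interpret S: prob_space "sticks \<theta>" using assms by (intro prob_space_sticks)
  note [measurable] = measurable_top_sum[OF measurable_sticks_component]
  have "measure (poisson_dirichlet \<theta>) F \<le> measure (sticks \<theta>) {u \<in> space (sticks \<theta>). \<exists>k. a \<le> top_sum k n u}"
    unfolding measure_poisson_dirichlet[OF F(1)]
  proof (intro S.finite_measure_mono subsetI)
    fix u assume "u \<in> {u \<in> space (sticks \<theta>). descending_rearrangement (stick_breaking u) \<in> F}"
    then have u: "\<And>i. u i \<in> {0<..<1}" "u \<in> space (sticks \<theta>)"
      and a: "a \<le> (\<Sum>i<n. descending_rearrangement (stick_breaking u) i)"
      using F(2) by (auto simp: space_sticks)
    obtain \<sigma> where \<sigma>: "bij \<sigma>" "descending_rearrangement (stick_breaking u) = stick_breaking u \<circ> \<sigma>"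
      using sorted_sticks_ex[of u] u by blast
    have inj: "inj_on \<sigma> {..<n}" using \<sigma>(1) by (auto simp: bij_def inj_on_def)
    have eq: "(\<Sum>i<n. descending_rearrangement (stick_breaking u) i) = sum (stick_breaking u) (\<sigma> ` {..<n})"
      using inj by (simp add: \<sigma>(2) sum.reindex)
    obtain k where "\<sigma> ` {..<n} \<subseteq> {..<k}" using finite_nat_iff_bounded[of "\<sigma> ` {..<n}"] by auto
    then have "sum (stick_breaking u) (\<sigma> ` {..<n}) \<le> top_sum k n u"
      using inj u by (intro stick_sum_le_top_sum) (auto simp: card_image)
    then show "u \<in> {u \<in> space (sticks \<theta>). \<exists>k. a \<le> top_sum k n u}"
      using u(2) order_trans[OF a[unfolded eq]] by blast
  qed measurable
  also have "\<dots> \<le> (1 + 1 / ((1 - \<rho>) * w)) ^ n * ((1 - a) / (1 - d)) powr (\<rho> * \<theta>)"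
    unfolding w_def using assms by (intro top_sum_tail) auto
  finally show ?thesis .
qed

section \<open>Prescribing the first breaks\<close>

lemma powr_at_top_0:
  assumes "0 \<le> q" "q < (1::real)"
  shows "((\<lambda>\<theta>. q powr \<theta>) \<longlongrightarrow> 0) at_top"
proof (cases "q = 0")
  case False
  have "filterlim (\<lambda>\<theta>. ln q * \<theta>) at_bot at_top"
    using assms False by (intro filterlim_tendsto_neg_mult_at_bot[OF tendsto_const] filterlim_ident) auto
  from filterlim_compose[OF exp_at_bot this] show ?thesis
    using False by (simp add: powr_def mult.commute)
qed simp

lemma measure_sticks_initial:
  assumes "0 < \<theta>" and ab: "\<And>i. i < N \<Longrightarrow> 0 \<le> a i \<and> a i \<le> b i \<and> b i \<le> 1"
    and B: "B \<in> sets (sticks \<theta>)"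
  defines "A \<equiv> {u \<in> space (sticks \<theta>). (\<forall>i<N. u i \<in> {a i<..<b i}) \<and> (\<lambda>i. u (i + N)) \<in> B}"
  shows "A \<in> sets (sticks \<theta>)"
    and "measure (sticks \<theta>) A = (\<Prod>i<N. (1 - a i) powr \<theta> - (1 - b i) powr \<theta>) * measure (sticks \<theta>) B"
proof -
  interpret B: prob_space "beta1 \<theta>" using assms by (intro prob_space_beta1)
  interpret S: prob_space "sticks \<theta>" using assms by (intro prob_space_sticks)
  interpret sequence_space "beta1 \<theta>" using assms by (intro sequence_space_beta1)
  have shift: "(\<lambda>u i. u (i + N)) \<in> measurable (sticks \<theta>) (sticks \<theta>)"
    by (rule measurable_PiM_single') (auto simp: space_PiM PiE_def Pi_def)
  note [measurable] = measurable_sticks_component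
  let ?C = "{u \<in> space (sticks \<theta>). \<forall>i<N. u i \<in> {a i<..<b i}}"
  have C: "?C \<in> sets (sticks \<theta>)" by measurable
  have "A = ?C \<inter> ((\<lambda>u i. u (i + N)) -` B \<inter> space (sticks \<theta>))" by (auto simp: A_def)
  then show A: "A \<in> sets (sticks \<theta>)" using C measurable_sets[OF shift B] by auto
  have comb: "(\<lambda>(v, w). comb_seq N v w) \<in> measurable (sticks \<theta> \<Otimes>\<^sub>M sticks \<theta>) (sticks \<theta>)"
    by measurable
  have pre: "(\<lambda>(v, w). comb_seq N v w) -` A \<inter> space (sticks \<theta> \<Otimes>\<^sub>M sticks \<theta>) = ?C \<times> B"
  proof -
    have "(\<lambda>i. comb_seq N v w (i + N)) = w" for v w :: "nat \<Rightarrow> real"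
      by (simp add: comb_seq_add)
    then show ?thesis using sets.sets_into_space[OF B]
      by (auto simp: A_def space_pair_measure space_sticks comb_seq_less split: split_comb_seq)
  qed
  have "emeasure (sticks \<theta>) A = emeasure (distr (sticks \<theta> \<Otimes>\<^sub>M sticks \<theta>) (sticks \<theta>) (\<lambda>(v, w). comb_seq N v w)) A"
    by (simp only: PiM_comb_seq)
  also have "\<dots> = emeasure (sticks \<theta> \<Otimes>\<^sub>M sticks \<theta>) (?C \<times> B)"
    by (simp add: emeasure_distr[OF comb A] pre)
  also have "\<dots> = emeasure (sticks \<theta>) ?C * emeasure (sticks \<theta>) B"
    by (rule S.emeasure_pair_measure_Times[OF C B])
  also have "emeasure (sticks \<theta>) ?C = (\<Prod>i<N. emeasure (beta1 \<theta>) {a i<..<b i})"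
  proof -
    have "?C = {u \<in> space (sticks \<theta>). \<forall>i\<in>{..<N}. u i \<in> {a i<..<b i}}" by auto
    moreover have "{a i<..<b i} \<in> sets (beta1 \<theta>)" if "i < N" for i
      using ab[OF that] unfolding sets_beta1 by (auto simp: sets_restrict_space_iff)
    ultimately show ?thesis by (simp only:) (intro emeasure_PiM_Collect, auto)
  qed
  also have "\<dots> = (\<Prod>i<N. ennreal ((1 - a i) powr \<theta> - (1 - b i) powr \<theta>))"
    using ab \<open>0 < \<theta>\<close> by (intro prod.cong refl emeasure_beta1_Ioo) auto
  also have "\<dots> = ennreal (\<Prod>i<N. (1 - a i) powr \<theta> - (1 - b i) powr \<theta>)"
    using ab \<open>0 < \<theta>\<close> by (intro prod_ennreal) (auto intro!: powr_mono2)
  finally have "emeasure (sticks \<theta>) A =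
      ennreal ((\<Prod>i<N. (1 - a i) powr \<theta> - (1 - b i) powr \<theta>) * measure (sticks \<theta>) B)"
    by (simp add: S.emeasure_eq_measure ennreal_mult'')
  moreover have "0 \<le> (\<Prod>i<N. (1 - a i) powr \<theta> - (1 - b i) powr \<theta>)"
    using ab \<open>0 < \<theta>\<close> by (intro prod_nonneg) (auto intro!: powr_mono2)
  ultimately show "measure (sticks \<theta>) A =
      (\<Prod>i<N. (1 - a i) powr \<theta> - (1 - b i) powr \<theta>) * measure (sticks \<theta>) B"
    by (simp add: measure_def)
qed

section \<open>Topology of the state space and the rate function\<close>

text \<open>
  Written with partial sums, every condition is closed in the product topology; the full sum itself
  is not continuous.
\<close>
lemma nabla_bar_sublevel:
  "{p \<in> nabla_bar. (\<Sum>k. p k) \<le> a} =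
    {p. (\<forall>k. p (Suc k) \<le> p k) \<and> (\<forall>k. 0 \<le> p k) \<and> (\<forall>n. (\<Sum>i<n. p i) \<le> min 1 a)}"
proof (intro set_eqI iffI)
  fix p assume "p \<in> {p \<in> nabla_bar. (\<Sum>k. p k) \<le> a}"
  then have p: "decseq p" "\<forall>k. 0 \<le> p k" "summable p" "(\<Sum>k. p k) \<le> min 1 a"
    by (auto simp: nabla_bar_def)
  have "(\<Sum>i<n. p i) \<le> min 1 a" for n
    using sum_le_suminf[OF p(3), of "{..<n}"] p by force
  then show "p \<in> {p. (\<forall>k. p (Suc k) \<le> p k) \<and> (\<forall>k. 0 \<le> p k) \<and> (\<forall>n. (\<Sum>i<n. p i) \<le> min 1 a)}"
    using p by (auto simp: decseq_Suc_iff)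
next
  fix p :: "nat \<Rightarrow> real"
  assume "p \<in> {p. (\<forall>k. p (Suc k) \<le> p k) \<and> (\<forall>k. 0 \<le> p k) \<and> (\<forall>n. (\<Sum>i<n. p i) \<le> min 1 a)}"
  then have p: "decseq p" "\<forall>k. 0 \<le> p k" "\<And>n. (\<Sum>i<n. p i) \<le> min 1 a"
    by (auto simp: decseq_Suc_iff)
  have "summable p" using p by (intro summableI_nonneg_bounded[where x = "min 1 a"]) auto
  moreover from this have "suminf p \<le> min 1 a" using p by (intro suminf_le_const) auto
  ultimately show "p \<in> {p \<in> nabla_bar. (\<Sum>k. p k) \<le> a}" using p by (auto simp: nabla_bar_def)
qed

lemma compact_nabla_bar_sublevel: "compact {p \<in> nabla_bar. (\<Sum>k. p k) \<le> a}"
proof -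
  let ?S = "{p \<in> nabla_bar. (\<Sum>k. p k) \<le> a}"
  have coord: "continuous_on UNIV (\<lambda>p::nat \<Rightarrow> real. p i)" for i
    by (rule continuous_on_product_coordinates)
  have "closed ?S" unfolding nabla_bar_sublevel
    by (intro closed_Collect_conj closed_Collect_all closed_Collect_le continuous_intros
        continuous_on_sum coord)
  moreover have "compact (PiE UNIV (\<lambda>_::nat. {0..1::real}))"
    using compactin_PiE[of "\<lambda>_::nat. euclidean :: real topology" UNIV "\<lambda>_. {0..1}"]
    by (simp add: euclidean_product_topology)
  moreover have "?S \<subseteq> PiE UNIV (\<lambda>_. {0..1})"
  proof
    fix p assume "p \<in> ?S"
    then have p: "\<forall>k. 0 \<le> p k" "\<forall>n. (\<Sum>i<n. p i) \<le> min 1 a" unfolding nabla_bar_sublevel by auto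
    have "p k \<le> 1" for k
    proof -
      have "p k \<le> (\<Sum>i<Suc k. p i)" using p(1) by (simp add: sum_nonneg)
      also have "\<dots> \<le> 1" using p(2) by (simp add: min_le_iff_disj del: sum.lessThan_Suc)
      finally show ?thesis .
    qed
    then show "p \<in> PiE UNIV (\<lambda>_. {0..1})" using p by auto
  qed
  ultimately show ?thesis using closed_Int_compact[of ?S "PiE UNIV (\<lambda>_. {0..1})"] by (simp only: Int_absorb2)
qed

lemma compact_nabla_bar: "compact nabla_bar"
  using compact_nabla_bar_sublevel[of 1] by (simp add: nabla_bar_def conj_ac)

lemma rate_S_le_iff:
  assumes "p \<in> nabla_bar"
  shows "rate_S p \<le> ereal c \<longleftrightarrow> (\<Sum>k. p k) \<le> 1 - exp (- c)"
proof (cases "(\<Sum>k. p k) < 1")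
  case True
  then have "rate_S p \<le> ereal c \<longleftrightarrow> ln (1 / (1 - (\<Sum>k. p k))) \<le> c"
    using assms by (simp add: rate_S_def)
  also have "\<dots> \<longleftrightarrow> - c \<le> ln (1 - (\<Sum>k. p k))" using True by (simp add: ln_div) linarith
  also have "\<dots> \<longleftrightarrow> exp (- c) \<le> 1 - (\<Sum>k. p k)" using True by (simp add: ln_ge_iff)
  finally show ?thesis by linarith
next
  case False
  then have "\<not> (\<Sum>k. p k) \<le> 1 - exp (- c)" using exp_gt_zero[of "- c"] by linarith
  then show ?thesis using False by (simp add: rate_S_def)
qed

lemma rate_S_nonneg: "0 \<le> rate_S p"
  by (auto simp: rate_S_def nabla_bar_def ln_div intro!: ln_le_zero_iff[THEN iffD2] suminf_nonneg)

lemma compact_rate_S_sublevel: "compact {p \<in> nabla_bar. rate_S p \<le> ereal c}"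
proof -
  have "{p \<in> nabla_bar. rate_S p \<le> ereal c} = {p \<in> nabla_bar. (\<Sum>k. p k) \<le> 1 - exp (- c)}"
    using rate_S_le_iff by auto
  then show ?thesis by (simp add: compact_nabla_bar_sublevel)
qed

text \<open>
  The product topology is coarser than the topology of uniform convergence.
\<close>
lemma open_fun_uniform_nhd:
  fixes U :: "(nat \<Rightarrow> real) set"
  assumes "open U" "p \<in> U"
  obtains e where "0 < e" "\<And>q. (\<And>i. \<bar>q i - p i\<bar> < e) \<Longrightarrow> q \<in> U"
proof -
  obtain X where X: "p \<in> PiE UNIV X" "\<And>i. open (X i)" "finite {i. X i \<noteq> UNIV}" "PiE UNIV X \<subseteq> U"
    using assms product_topology_open_contains_basis[of "\<lambda>_::nat. euclidean :: real topology" UNIV U p]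
    by (auto simp: euclidean_product_topology)
  define J where "J = {i. X i \<noteq> UNIV}"
  have "\<exists>e>0. \<forall>y. \<bar>y - p i\<bar> < e \<longrightarrow> y \<in> X i" for i
    using X(1) X(2)[of i] by (auto simp: open_dist dist_real_def)
  then obtain e where e: "\<And>i. 0 < e i" "\<And>i y. \<bar>y - p i\<bar> < e i \<Longrightarrow> y \<in> X i" by metis
  define d where "d = Min (insert 1 (e ` J))"
  have fin: "finite (insert 1 (e ` J))" using X(3) by (simp add: J_def)
  have "0 < d" using fin e(1) by (auto simp: d_def)
  moreover have "q \<in> U" if q: "\<And>i. \<bar>q i - p i\<bar> < d" for q
  proof -
    have "q i \<in> X i" for i
    proof (cases "i \<in> J")
      case True
      then have "d \<le> e i" using fin by (simp add: d_def)
      then show ?thesis using q[of i] by (intro e(2)) auto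
    qed (simp add: J_def)
    then show ?thesis using X(4) by auto
  qed
  ultimately show ?thesis by (rule that)
qed

section \<open>Upper bound for closed sets\<close>

text \<open>
  On \<open>F\<close> the total mass exceeds \<open>a = 1 - exp (- c)\<close> for some \<open>c > b\<close>. By compactness one \<open>n\<close> suffices
  for the first \<open>n\<close> entries of every point of \<open>F\<close> to have sum above \<open>a\<close>, and the tail bound applies.
  The gap between \<open>b\<close> and \<open>c\<close> pays for the loss in \<open>\<rho>\<close> and \<open>d\<close> and for the constant.
\<close>
lemma eventually_poisson_dirichlet_closed:
  assumes F: "closedin (top_of_set nabla_bar) F" and b: "0 < b" "ereal b < (INF p\<in>F. rate_S p)"
  shows "\<forall>\<^sub>F \<theta> in at_top. measure (poisson_dirichlet \<theta>) F \<le> exp (- b * \<theta>)"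
proof -
  have sub: "F \<subseteq> nabla_bar" using closedin_subset[OF F] by simp
  have "compact F" using F compact_nabla_bar closedin_compact by blast
  have meas: "F \<in> sets (restrict_space borel nabla_bar)"
  proof -
    obtain C where "closed C" "F = nabla_bar \<inter> C" using F unfolding closedin_closed by blast
    then show ?thesis unfolding sets_restrict_space using borel_closed by blast
  qed
  obtain c where c: "b < c" "ereal c < (INF p\<in>F. rate_S p)"
    using ereal_dense2[OF b(2)] by auto
  define a where "a = 1 - exp (- c)"
  have a: "0 \<le> a" "a < 1" using b c by (auto simp: a_def)
  have big: "a < (\<Sum>k. p k)" if "p \<in> F" for p
  proof -
    have "ereal c < rate_S p" using c(2) that by (rule less_INF_D)
    then show ?thesis using rate_S_le_iff[of p c] sub that by (auto simp: a_def not_le[symmetric])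
  qed
  obtain n where n: "\<And>p. p \<in> F \<Longrightarrow> a \<le> (\<Sum>i<n. p i)"
  proof -
    have op: "open {p. a < (\<Sum>i<n. p i)}" for n
      by (intro open_Collect_less continuous_intros continuous_on_sum continuous_on_product_coordinates)
    have cover: "F \<subseteq> (\<Union>n\<in>UNIV. {p. a < (\<Sum>i<n. p i)})"
    proof
      fix p assume p: "p \<in> F"
      have "\<exists>n. a < (\<Sum>i<n. p i)"
      proof (rule ccontr)
        assume "\<nexists>n. a < (\<Sum>i<n. p i)"
        moreover have "summable p" using p sub by (auto simp: nabla_bar_def)
        ultimately have "suminf p \<le> a" by (intro suminf_le_const) (auto simp: not_less)
        then show False using big[OF p] by simp
      qed
      then show "p \<in> (\<Union>n\<in>UNIV. {p. a < (\<Sum>i<n. p i)})" by auto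
    qed
    obtain T where T: "finite T" "F \<subseteq> (\<Union>n\<in>T. {p. a < (\<Sum>i<n. p i)})"
      by (rule compactE_image[OF \<open>compact F\<close> op cover])
    show ?thesis
    proof (rule that[of "Max (insert 0 T)"])
      fix p assume p: "p \<in> F"
      then obtain m where m: "m \<in> T" "a < (\<Sum>i<m. p i)" using T(2) by auto
      have "(\<Sum>i<m. p i) \<le> (\<Sum>i<Max (insert 0 T). p i)"
        using m T(1) p sub by (intro sum_mono2) (auto simp: nabla_bar_def intro: less_le_trans)
      then show "a \<le> (\<Sum>i<Max (insert 0 T). p i)" using m by simp
    qed
  qed
  \<comment> \<open>The tail bound has the rate \<open>\<rho> * (c - e)\<close>; \<open>\<rho>\<close> makes it \<open>b + e\<close>, so that \<open>exp (e * \<theta>)\<close>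
    is left to absorb the constant \<open>K\<close>.\<close>
  define e where "e = (c - b) / 3"
  define \<rho> where "\<rho> = (b + e) / (b + 2 * e)"
  define d where "d = 1 - exp (- e)"
  have e: "0 < e" using c by (simp add: e_def)
  have \<rho>: "0 < \<rho>" "\<rho> < 1" using b e by (auto simp: \<rho>_def)
  have ce: "\<rho> * (c - e) = b + e"
  proof -
    have "c - e = b + 2 * e" by (simp add: e_def field_simps)
    then have "\<rho> * (c - e) = (b + e) / (b + 2 * e) * (b + 2 * e)" by (simp only: \<rho>_def)
    also have "\<dots> = b + e" using b e by simp
    finally show ?thesis .
  qed
  have d: "0 < d" "d < 1" using e by (auto simp: d_def)
  define K where "K = (1 + 1 / ((1 - \<rho>) * ((\<rho> * d / (1 - d)) / (1 + \<rho> * d / (1 - d))))) ^ n"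
  have "filterlim (\<lambda>\<theta>. exp (e * \<theta>)) at_top at_top"
    using e by (intro filterlim_compose[OF exp_at_top] filterlim_tendsto_pos_mult_at_top[OF tendsto_const]
        filterlim_ident)
  then have "\<forall>\<^sub>F \<theta> in at_top. K \<le> exp (e * \<theta>)" by (simp add: filterlim_at_top)
  moreover have "\<forall>\<^sub>F \<theta>::real in at_top. 0 < \<theta>" by (rule eventually_gt_at_top)
  ultimately show ?thesis
  proof eventually_elim
    case (elim \<theta>)
    have "(1 - a) / (1 - d) = exp (- (c - e))" by (simp add: a_def d_def exp_diff exp_minus field_simps)
    then have pw: "((1 - a) / (1 - d)) powr (\<rho> * \<theta>) = exp (- (\<rho> * (c - e)) * \<theta>)"
      by (simp add: powr_def algebra_simps)
    have "measure (poisson_dirichlet \<theta>) F \<le> K * ((1 - a) / (1 - d)) powr (\<rho> * \<theta>)"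
      unfolding K_def using elim \<rho> d a meas n by (intro poisson_dirichlet_tail) auto
    also have "\<dots> = K * exp (- (b + e) * \<theta>)" by (simp only: pw ce)
    also have "\<dots> \<le> exp (e * \<theta>) * exp (- (b + e) * \<theta>)" using elim by (intro mult_right_mono) auto
    also have "\<dots> = exp (- b * \<theta>)" by (simp add: exp_add[symmetric] algebra_simps)
    finally show ?case .
  qed
qed

section \<open>Lower bound for open sets\<close>

text \<open>
  As \<open>\<theta>\<close> grows all sticks become small; \<open>top_sum_tail\<close> with \<open>n = 1\<close> proves it.
\<close>
lemma eventually_small_sticks:
  assumes "0 < e"
  obtains B where "\<And>\<theta>. B \<theta> \<in> sets (sticks \<theta>)" "\<forall>\<^sub>F \<theta> in at_top. 1 / 2 \<le> measure (sticks \<theta>) (B \<theta>)"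
    "\<And>\<theta> u i. u \<in> B \<theta> \<Longrightarrow> stick_breaking u i < e"
proof -
  define a where "a = min e (1 / 2)"
  have a: "0 < a" "a < 1" "a \<le> e" using assms by (auto simp: a_def)
  define T where "T = (\<lambda>\<theta>. {u \<in> space (sticks \<theta>). \<exists>k. a \<le> top_sum k 1 u})"
  define q where "q = (1 - a) / (1 - a / 2)"
  define K where "K = (1 + 1 / ((1 - 1 / 2) * ((1 / 2 * (a / 2) / (1 - a / 2)) / (1 + 1 / 2 * (a / 2) / (1 - a / 2)))))"
  have q: "0 \<le> q" "q < 1" using a by (auto simp: q_def)
  note [measurable] = measurable_top_sum[OF measurable_sticks_component]
  have T: "T \<theta> \<in> sets (sticks \<theta>)" for \<theta> unfolding T_def by measurable
  have "((\<lambda>\<theta>. K * (q powr (1 / 2)) powr \<theta>) \<longlongrightarrow> K * 0) at_top"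
    using q powr_less_mono2[of "1 / 2" q 1] by (intro tendsto_intros powr_at_top_0) auto
  then have "\<forall>\<^sub>F \<theta> in at_top. K * (q powr (1 / 2)) powr \<theta> < 1 / 2" by (rule order_tendstoD) simp
  moreover have "\<forall>\<^sub>F \<theta>::real in at_top. 0 < \<theta>" by (rule eventually_gt_at_top)
  ultimately have "\<forall>\<^sub>F \<theta> in at_top. 1 / 2 \<le> measure (sticks \<theta>) (space (sticks \<theta>) - T \<theta>)"
  proof eventually_elim
    case (elim \<theta>)
    interpret S: prob_space "sticks \<theta>" using elim by (intro prob_space_sticks)
    have "measure (sticks \<theta>) (T \<theta>) \<le> K ^ 1 * q powr (1 / 2 * \<theta>)"
      unfolding K_def T_def q_def using elim a by (intro top_sum_tail) auto
    also have "\<dots> < 1 / 2" using elim by (simp add: powr_powr)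
    finally show ?case using S.prob_compl[OF T[of \<theta>]] by simp
  qed
  moreover have "stick_breaking u i < e" if "u \<in> space (sticks \<theta>) - T \<theta>" for u \<theta> i
  proof -
    have "\<And>i. u i \<in> {0<..<1}" using that by (auto simp: space_sticks)
    from stick_sum_le_top_sum[of u "{i}" "Suc i" 1, OF this]
    have "stick_breaking u i \<le> top_sum (Suc i) 1 u" by simp
    also have "\<dots> < a" using that unfolding T_def by (auto simp: not_le simp del: top_sum.simps One_nat_def)
    finally show ?thesis using a by simp
  qed
  moreover have "space (sticks \<theta>) - T \<theta> \<in> sets (sticks \<theta>)" for \<theta> using T by auto
  ultimately show ?thesis using that[of "\<lambda>\<theta>. space (sticks \<theta>) - T \<theta>"] by blast
qed

text \<open>
  Prescribe the sticks in the order \<open>p\<close> lists them. The break that produces \<open>p i\<close> takes the fraction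
  \<open>a i\<close> of the remaining length \<open>R i\<close>. Let the break \<open>i\<close> land in \<open>(a i, b i)\<close> for
  \<open>i < N\<close>; this has probability \<open>(1 - a i) powr \<theta>\<close> up to a factor tending to \<open>1\<close>, and the
  product of the \<open>1 - a i\<close> telescopes to \<open>R N\<close>, which is at least one minus the mass of \<open>p\<close>. The
  remaining sticks are uniformly small with probability at least one half, and so is \<open>p\<close> from \<open>N\<close>
  on.
\<close>
lemma eventually_sticks_close:
  assumes p: "p \<in> nabla_bar" and s: "(\<Sum>k. p k) < 1" and "0 < e"
  obtains K where "0 < K" "\<forall>\<^sub>F \<theta> in at_top. K * (1 - (\<Sum>k. p k)) powr \<theta> \<le>
    measure (sticks \<theta>) {u \<in> space (sticks \<theta>). \<forall>i. \<bar>stick_breaking u i - p i\<bar> < e}"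
proof -
  define R where "R = (\<lambda>n. 1 - (\<Sum>i<n. p i))"
  define a where "a = (\<lambda>i. p i / R i)"
  have pn: "0 \<le> p i" for i using p by (simp add: nabla_bar_def)
  have sp: "summable p" using p by (simp add: nabla_bar_def)
  have R: "1 - (\<Sum>k. p k) \<le> R n" for n
    using sum_le_suminf[OF sp, of "{..<n}"] pn by (simp add: R_def)
  have Rpos: "0 < R n" for n using R[of n] s by simp
  have RS: "R (Suc n) = R n - p n" for n by (simp add: R_def)
  have a01: "0 \<le> a i" "a i < 1" for i
    using pn[of i] Rpos[of i] Rpos[of "Suc i"] by (auto simp: a_def RS)
  have prod: "(\<Prod>i<n. 1 - a i) = R n" for n
  proof (induction n)
    case 0
    show ?case by (simp add: R_def)
  next
    case (Suc n)
    then show ?case using Rpos[of n] by (simp add: RS a_def field_simps)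
  qed
  have stick_a: "stick_breaking a i = p i" for i
    using Rpos[of i] unfolding stick_breaking_def prod by (simp add: a_def)
  obtain N where N: "\<And>j. N \<le> j \<Longrightarrow> p j < e"
    using order_tendstoD(2)[OF summable_LIMSEQ_zero[OF sp] \<open>0 < e\<close>]
    by (auto simp: eventually_sequentially)
  define U where "U = (\<Inter>i\<in>{..<N}. {u :: nat \<Rightarrow> real. \<bar>stick_breaking u i - p i\<bar> < e \<and> u i < 1})"
  have "open U"
    unfolding U_def stick_breaking_def
    by (intro open_INT ballI open_Collect_conj open_Collect_less continuous_intros
        continuous_on_prod continuous_on_product_coordinates) simp_all
  moreover have "a \<in> U" using a01 \<open>0 < e\<close> by (simp add: U_def stick_a)
  ultimately obtain h where h: "0 < h" "\<And>u. (\<And>i. \<bar>u i - a i\<bar> < h) \<Longrightarrow> u \<in> U"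
    using open_fun_uniform_nhd by blast
  define b where "b = (\<lambda>i. a i + h / 2)"
  have "b \<in> U" using h(1) by (intro h(2)) (simp add: b_def)
  then have b: "a i < b i" "b i < 1" if "i < N" for i
    using that h(1) by (auto simp: U_def b_def)
  obtain B where B: "\<And>\<theta>. B \<theta> \<in> sets (sticks \<theta>)"
    "\<forall>\<^sub>F \<theta> in at_top. 1 / 2 \<le> measure (sticks \<theta>) (B \<theta>)"
    "\<And>\<theta> u i. u \<in> B \<theta> \<Longrightarrow> stick_breaking u i < e"
    using eventually_small_sticks[OF \<open>0 < e\<close>] by blast
  define A where "A = (\<lambda>\<theta>. {u \<in> space (sticks \<theta>). (\<forall>i<N. u i \<in> {a i<..<b i}) \<and> (\<lambda>i. u (i + N)) \<in> B \<theta>})"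
  have close: "\<bar>stick_breaking u i - p i\<bar> < e" if u: "u \<in> A \<theta>" for u i \<theta>
  proof (cases "i < N")
    case True
    \<comment> \<open>Membership in \<open>U\<close> only concerns the first \<open>N\<close> breaks, so the others may be reset to \<open>a\<close>.\<close>
    define v where "v = (\<lambda>i. if i < N then u i else a i)"
    have "v \<in> U"
    proof (rule h(2))
      fix i
      have "a i < u i \<and> u i < b i" if "i < N" using u that by (auto simp: A_def)
      then show "\<bar>v i - a i\<bar> < h" using h(1) by (auto simp: v_def b_def)
    qed
    then have "\<bar>stick_breaking v i - p i\<bar> < e" using True by (auto simp: U_def)
    moreover have "stick_breaking v i = stick_breaking u i"
      using True unfolding stick_breaking_def v_def by (intro arg_cong2[where f="(*)"] prod.cong) auto
    ultimately show ?thesis by simp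
  next
    case False
    have u01: "u j \<in> {0<..<1}" for j using u by (auto simp: A_def space_sticks)
    obtain k where k: "i = N + k" using False by (metis le_iff_add not_less)
    let ?v = "\<lambda>j. u (N + j)"
    have "?v \<in> B \<theta>" using u by (simp add: A_def add.commute)
    then have "stick_breaking ?v k < e" by (rule B(3))
    moreover have "stick_breaking u i \<le> stick_breaking ?v k"
    proof -
      have "(\<Prod>j<N. 1 - u j) \<le> 1" using u01 by (intro prod_le_1) (auto simp: less_imp_le)
      moreover have "0 \<le> (\<Prod>j<N. 1 - u j)" using u01 by (intro prod_nonneg) (auto simp: less_imp_le)
      moreover have "0 \<le> stick_breaking ?v k" using u01 by (intro less_imp_le stick_breaking_pos)
      ultimately show ?thesis unfolding k stick_breaking_add by (intro mult_left_le_one_le)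
    qed
    moreover have "0 < stick_breaking u i" using u01 by (rule stick_breaking_pos)
    moreover have "p i < e" using N False by simp
    ultimately show ?thesis using pn[of i] by linarith
  qed
  have ratio: "\<forall>\<^sub>F \<theta> in at_top. ((1 - b i) / (1 - a i)) powr \<theta> < 1 / 2" if "i < N" for i
  proof -
    have "((\<lambda>\<theta>. ((1 - b i) / (1 - a i)) powr \<theta>) \<longlongrightarrow> 0) at_top"
      using b[OF that] a01[of i] by (intro powr_at_top_0) auto
    then show ?thesis by (rule order_tendstoD) simp
  qed
  have ratios: "\<forall>\<^sub>F \<theta> in at_top. \<forall>i\<in>{..<N}. ((1 - b i) / (1 - a i)) powr \<theta> < 1 / 2"
    using ratio by (intro eventually_ball_finite) auto
  show ?thesis
  proof (rule that[of "(1 / 2) ^ N * (1 / 2)"])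
    have "\<forall>\<^sub>F \<theta>::real in at_top. 0 < \<theta>" by (rule eventually_gt_at_top)
    with ratios B(2) show "\<forall>\<^sub>F \<theta> in at_top. (1 / 2) ^ N * (1 / 2) * (1 - (\<Sum>k. p k)) powr \<theta> \<le>
      measure (sticks \<theta>) {u \<in> space (sticks \<theta>). \<forall>i. \<bar>stick_breaking u i - p i\<bar> < e}"
    proof eventually_elim
      case (elim \<theta>)
      interpret S: prob_space "sticks \<theta>" using elim by (intro prob_space_sticks)
      have step: "1 / 2 * (1 - a i) powr \<theta> \<le> (1 - a i) powr \<theta> - (1 - b i) powr \<theta>" if "i < N" for i
      proof -
        have "(1 - b i) powr \<theta> = ((1 - b i) / (1 - a i)) powr \<theta> * (1 - a i) powr \<theta>"
          using b[OF that] a01[of i] by (simp add: powr_divide)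
        also have "\<dots> \<le> 1 / 2 * (1 - a i) powr \<theta>"
          using elim that by (intro mult_right_mono) (auto intro: less_imp_le)
        finally show ?thesis by simp
      qed
      have "(1 / 2) ^ N * (1 / 2) * (1 - (\<Sum>k. p k)) powr \<theta> \<le> (1 / 2) ^ N * R N powr \<theta> * (1 / 2)"
        using R[of N] s elim powr_mono2[of \<theta> "1 - (\<Sum>k. p k)" "R N"] by simp
      also have "(1 / 2) ^ N * R N powr \<theta> = (\<Prod>i<N. 1 / 2 * (1 - a i) powr \<theta>)"
      proof -
        have "R N powr \<theta> = (\<Prod>i<N. (1 - a i) powr \<theta>)"
          unfolding prod[symmetric] by (rule prod_powr_distrib)
        then show ?thesis unfolding prod.distrib prod_constant card_lessThan by simp
      qed
      also have "\<dots> * (1 / 2) \<le> (\<Prod>i<N. (1 - a i) powr \<theta> - (1 - b i) powr \<theta>) * measure (sticks \<theta>) (B \<theta>)"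
      proof (rule mult_mono)
        show le: "(\<Prod>i<N. 1 / 2 * (1 - a i) powr \<theta>) \<le> (\<Prod>i<N. (1 - a i) powr \<theta> - (1 - b i) powr \<theta>)"
          using step by (intro prod_mono) auto
        have "0 \<le> (\<Prod>i<N. 1 / 2 * (1 - a i) powr \<theta>)" by (intro prod_nonneg) auto
        with le show "0 \<le> (\<Prod>i<N. (1 - a i) powr \<theta> - (1 - b i) powr \<theta>)" by linarith
      qed (use elim in auto)
      also have "\<dots> = measure (sticks \<theta>) (A \<theta>)"
        unfolding A_def using elim a01 b B(1)
        by (intro measure_sticks_initial(2)[symmetric]) (auto simp: less_imp_le)
      also have "\<dots> \<le> measure (sticks \<theta>) {u \<in> space (sticks \<theta>). \<forall>i. \<bar>stick_breaking u i - p i\<bar> < e}"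
      proof (rule S.finite_measure_mono)
        show "A \<theta> \<subseteq> {u \<in> space (sticks \<theta>). \<forall>i. \<bar>stick_breaking u i - p i\<bar> < e}"
          using close by (auto simp: A_def)
        note [measurable] = measurable_stick_breaking
        show "{u \<in> space (sticks \<theta>). \<forall>i. \<bar>stick_breaking u i - p i\<bar> < e} \<in> sets (sticks \<theta>)"
          by measurable
      qed
      finally show ?case .
    qed
  qed simp
qed

lemma eventually_poisson_dirichlet_open:
  assumes G: "openin (top_of_set nabla_bar) G" and p: "p \<in> G" "(\<Sum>k. p k) < 1"
  obtains K where "0 < K"
    "\<forall>\<^sub>F \<theta> in at_top. K * (1 - (\<Sum>k. p k)) powr \<theta> \<le> measure (poisson_dirichlet \<theta>) G"
proof -
  obtain U where U: "open U" "G = nabla_bar \<inter> U" using G unfolding openin_open by blast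
  obtain e where e: "0 < e" "\<And>q. (\<And>i. \<bar>q i - p i\<bar> < e) \<Longrightarrow> q \<in> U"
    using open_fun_uniform_nhd[of U p] U p by blast
  have pn: "p \<in> nabla_bar" using U p by auto
  have G_sets: "G \<in> sets (restrict_space borel nabla_bar)"
    using U unfolding sets_restrict_space using borel_open by blast
  obtain K where K: "0 < K" "\<forall>\<^sub>F \<theta> in at_top. K * (1 - (\<Sum>k. p k)) powr \<theta> \<le>
    measure (sticks \<theta>) {u \<in> space (sticks \<theta>). \<forall>i. \<bar>stick_breaking u i - p i\<bar> < e}"
    using eventually_sticks_close[OF pn p(2) e(1)] by blast
  have "\<forall>\<^sub>F \<theta>::real in at_top. 0 < \<theta>" by (rule eventually_gt_at_top)
  with K(2) have "\<forall>\<^sub>F \<theta> in at_top. K * (1 - (\<Sum>k. p k)) powr \<theta> \<le> measure (poisson_dirichlet \<theta>) G"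
  proof eventually_elim
    case (elim \<theta>)
    interpret S: prob_space "sticks \<theta>" using elim by (intro prob_space_sticks)
    have "measure (sticks \<theta>) {u \<in> space (sticks \<theta>). \<forall>i. \<bar>stick_breaking u i - p i\<bar> < e} \<le>
      measure (sticks \<theta>) {u \<in> space (sticks \<theta>). descending_rearrangement (stick_breaking u) \<in> G}"
    proof (rule S.finite_measure_mono)
      show "{u \<in> space (sticks \<theta>). \<forall>i. \<bar>stick_breaking u i - p i\<bar> < e} \<subseteq>
        {u \<in> space (sticks \<theta>). descending_rearrangement (stick_breaking u) \<in> G}"
      proof safe
        fix u assume u: "u \<in> space (sticks \<theta>)" "\<forall>i. \<bar>stick_breaking u i - p i\<bar> < e"
        then have u01: "\<And>i. u i \<in> {0<..<1}" by (simp add: space_sticks)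
        have "\<bar>descending_rearrangement (stick_breaking u) k - p k\<bar> < e" for k
          using u(2) pn
          by (intro descending_rearrangement_nonexpansive stick_breaking_pos stick_breaking_lim u01)
            (auto simp: nabla_bar_def)
        then show "descending_rearrangement (stick_breaking u) \<in> G"
          using e(2) sorted_sticks_in_nabla[OF u01] U(2) by auto
      qed
      have "{u \<in> space (sticks \<theta>). descending_rearrangement (stick_breaking u) \<in> G} =
        (\<lambda>u. descending_rearrangement (stick_breaking u)) -` G \<inter> space (sticks \<theta>)" by auto
      then show "{u \<in> space (sticks \<theta>). descending_rearrangement (stick_breaking u) \<in> G} \<in> sets (sticks \<theta>)"
        using measurable_sets[OF measurable_sorted_sticks G_sets] by simp
    qed
    with elim show ?case by (simp add: measure_poisson_dirichlet[OF G_sets])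
  qed
  with K(1) show ?thesis by (rule that)
qed

section \<open>The large deviation principle\<close>

lemma Limsup_log_ext_le:
  fixes m :: "real \<Rightarrow> real"
  assumes "\<And>\<theta>. 0 \<le> m \<theta>" "\<forall>\<^sub>F \<theta> in at_top. m \<theta> \<le> exp (- b * \<theta>)"
  shows "Limsup at_top (\<lambda>\<theta>. ereal (1 / \<theta>) * log_ext (m \<theta>)) \<le> ereal (- b)"
proof (rule Limsup_bounded)
  have "\<forall>\<^sub>F \<theta>::real in at_top. 0 < \<theta>" by (rule eventually_gt_at_top)
  with assms(2) show "\<forall>\<^sub>F \<theta> in at_top. ereal (1 / \<theta>) * log_ext (m \<theta>) \<le> ereal (- b)"
  proof eventually_elim
    case (elim \<theta>)
    show ?case
    proof (cases "m \<theta> = 0")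
      case False
      then have "0 < m \<theta>" using assms(1)[of \<theta>] by simp
      with elim have "ln (m \<theta>) \<le> - b * \<theta>" by (metis ln_exp ln_le_cancel_iff exp_gt_zero)
      then show ?thesis using False elim by (simp add: log_ext_def field_simps)
    qed (use elim in \<open>simp add: log_ext_def\<close>)
  qed
qed

lemma Liminf_log_ext_ge:
  fixes m :: "real \<Rightarrow> real"
  assumes "0 < K" "0 < r" "\<forall>\<^sub>F \<theta> in at_top. K * r powr \<theta> \<le> m \<theta>"
  shows "ereal (ln r) \<le> Liminf at_top (\<lambda>\<theta>. ereal (1 / \<theta>) * log_ext (m \<theta>))"
proof -
  have "((\<lambda>\<theta>. ln K * inverse \<theta> + ln r) \<longlongrightarrow> ln K * 0 + ln r) at_top"
    by (intro tendsto_intros tendsto_inverse_0_at_top filterlim_ident)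
  then have "((\<lambda>\<theta>. ereal (ln K * inverse \<theta> + ln r)) \<longlongrightarrow> ereal (ln r)) at_top" by simp
  then have "ereal (ln r) = Liminf at_top (\<lambda>\<theta>. ereal (ln K * inverse \<theta> + ln r))"
    by (intro lim_imp_Liminf[symmetric]) auto
  also have "\<dots> \<le> Liminf at_top (\<lambda>\<theta>. ereal (1 / \<theta>) * log_ext (m \<theta>))"
  proof (rule Liminf_mono)
    have "\<forall>\<^sub>F \<theta>::real in at_top. 0 < \<theta>" by (rule eventually_gt_at_top)
    with assms(3) show "\<forall>\<^sub>F \<theta> in at_top. ereal (ln K * inverse \<theta> + ln r) \<le> ereal (1 / \<theta>) * log_ext (m \<theta>)"
    proof eventually_elim
      case (elim \<theta>)
      have pos: "0 < K * r powr \<theta>" using assms by simp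
      have "ln K + \<theta> * ln r = ln (K * r powr \<theta>)" using assms by (simp add: ln_mult ln_powr)
      also have "\<dots> \<le> ln (m \<theta>)" using elim pos by (intro ln_mono) auto
      finally have "ln K + \<theta> * ln r \<le> ln (m \<theta>)" .
      then have "(ln K + \<theta> * ln r) / \<theta> \<le> ln (m \<theta>) / \<theta>" using elim by (intro divide_right_mono) auto
      also have "(ln K + \<theta> * ln r) / \<theta> = ln K * inverse \<theta> + ln r" using elim by (simp add: field_simps)
      finally have "ln K * inverse \<theta> + ln r \<le> 1 / \<theta> * ln (m \<theta>)" by simp
      moreover have "m \<theta> \<noteq> 0" using elim pos by linarith
      ultimately show ?case by (simp add: log_ext_def)
    qed
  qed
  finally show ?thesis .
qed

lemma poisson_dirichlet_upper_bound:
  assumes "closedin (top_of_set nabla_bar) F"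
  shows "Limsup at_top (\<lambda>\<theta>. ereal (1 / \<theta>) * log_ext (measure (poisson_dirichlet \<theta>) F)) \<le> - (INF p\<in>F. rate_S p)"
    (is "?L \<le> - ?I")
proof (rule ccontr)
  have "\<forall>\<^sub>F \<theta>::real in at_top. 0 < \<theta>" by (rule eventually_gt_at_top)
  then have "\<forall>\<^sub>F \<theta> in at_top. measure (poisson_dirichlet \<theta>) F \<le> exp (- 0 * \<theta>)"
    by eventually_elim (use prob_space_poisson_dirichlet prob_space.prob_le_1 in fastforce)
  \<comment> \<open>The rate \<open>0\<close> first: it shows that the rate \<open>b\<close> chosen below is positive.\<close>
  then have "?L \<le> ereal (- 0)" by (intro Limsup_log_ext_le) auto
  then have "?L \<le> 0" by (simp only: zero_ereal_def minus_zero)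
  then have L0: "0 \<le> - ?L" by simp
  assume "\<not> ?L \<le> - ?I"
  then have "- ?L < ?I" by (metis ereal_minus_less_minus ereal_uminus_uminus not_le)
  then obtain b where b: "- ?L < ereal b" "ereal b < ?I" using ereal_dense2 by blast
  have "0 < b" using L0 b(1) by (metis ereal_less(2) le_less_trans)
  then have "?L \<le> ereal (- b)"
    using eventually_poisson_dirichlet_closed[OF assms _ b(2)] by (intro Limsup_log_ext_le) auto
  then have "ereal b \<le> - ?L" by (metis ereal_minus_le_minus ereal_uminus_uminus uminus_ereal.simps(1))
  with b(1) show False by simp
qed

lemma poisson_dirichlet_lower_bound:
  assumes G: "openin (top_of_set nabla_bar) G"
  shows "- (INF p\<in>G. rate_S p) \<le> Liminf at_top (\<lambda>\<theta>. ereal (1 / \<theta>) * log_ext (measure (poisson_dirichlet \<theta>) G))"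
    (is "- ?I \<le> ?L")
proof -
  have "- ?L \<le> ?I"
  proof (rule INF_greatest)
    fix p assume p: "p \<in> G"
    show "- ?L \<le> rate_S p"
    proof (cases "(\<Sum>k. p k) < 1")
      case True
      obtain K where "0 < K"
        "\<forall>\<^sub>F \<theta> in at_top. K * (1 - (\<Sum>k. p k)) powr \<theta> \<le> measure (poisson_dirichlet \<theta>) G"
        using eventually_poisson_dirichlet_open[OF G p True] by blast
      then have "ereal (ln (1 - (\<Sum>k. p k))) \<le> ?L" using True by (intro Liminf_log_ext_ge) auto
      then have "- ?L \<le> ereal (- ln (1 - (\<Sum>k. p k)))"
        by (metis ereal_minus_le_minus uminus_ereal.simps(1))
      also have "\<dots> = rate_S p"
        using True p openin_imp_subset[OF G] by (auto simp: rate_S_def ln_div)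
      finally show ?thesis .
    qed (simp add: rate_S_def)
  qed
  then show ?thesis by (metis ereal_minus_le_minus ereal_uminus_uminus)
qed

theorem theorem4p4:
  shows "satisfies_LDP nabla_bar poisson_dirichlet rate_S"
  unfolding satisfies_LDP_def
  using compact_imp_complete[OF compact_nabla_bar] prob_space_poisson_dirichlet
    space_poisson_dirichlet sets_poisson_dirichlet rate_S_nonneg
    poisson_dirichlet_upper_bound poisson_dirichlet_lower_bound compact_rate_S_sublevel
  by simp

end
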